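(* Let $n\ge1$, let $c\in\pm\mathcal E_n''$, and consider $(c,\tilde e_0),(\tilde e_0,\gamma_n c)\in\mathcal A_{n+1}$. Their values of $\chi$ are equal, where $\chi((x,y))=\gamma_n\frac{n(x)}{n(y)}$. (1) If $\chi=1$, then $(c,\tilde e_0)$ and $(\tilde e_0,\gamma_n c)$ are each orthogonal to themselves, and all edges in $\Gamma_e(\mathcal A_{n+1})$ containing them are the three edges of the path $$(\tilde c,-\gamma_{n-1}e_0)\longleftrightarrow(c,\tilde e_0)\longleftrightarrow(\tilde e_0,\gamma_n c)\longleftrightarrow(\tilde c,\gamma_{n-1}e_0).$$ (2) If $\chi=-1$, then each of $(c,\tilde e_0)$ and $(\tilde e_0,\gamma_n c)$ is adjacent in $\Gamma_e(\mathcal A_{n+1})$ to all $(a,b)\in Z_e'(\mathcal A_{n+1})$ such that $a\perp\mathbb H_c=\mathrm{Lin}(e_0,c,\tilde e_0,\tilde c)$ and $ab=\gamma_{n-1}n(b)\tilde c$, and only to them. Besides, in this case $(c,\tilde e_0)$ and $(\tilde e_0,\gamma_n c)$ are zero divisors in $\mathcal A_{n+1}$, i.e. (up to sign) belong to $Z_e'(\mathcal A_{n+1})$, if and only if $n\ge3$.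
   Context: Real Cayley–Dickson algebras: $\mathcal A_0=\mathbb R$ with trivial involution. Given parameters $\gamma_0,\gamma_1,\dots\in\{\pm1\}$ (the paper's normalization of nonzero real parameters), $\mathcal A_{k+1}=\mathcal A_k\times\mathcal A_k$ with componentwise addition and real scaling, product $(a,b)(c,d)=(ac+\gamma_k\bar d b,\ da+b\bar c)$ and involution $\overline{(a,b)}=(\bar a,-b)$. The norm is $n(a)=a\bar a\in\mathbb R$; $\perp$ refers to the bilinear form $\langle a,b\rangle=\frac12(a\bar b+b\bar a)$; $\mathrm{Lin}$ is the real linear span. Standard basis: $e^{(0)}_0=1$; $e^{(k+1)}_j=(e^{(k)}_j,0)$ for $0\le j<2^k$ and $e^{(k+1)}_j=(0,e^{(k)}_{j-2^k})$ for $2^k\le j<2^{k+1}$; $e_0=e_0^{(n)}$ is the unity. In $\mathcal A_n$, $\tilde e_0=(0,e_0)=e^{(n)}_{2^{n-1}}$ and $\tilde x=x\tilde e_0$. $\mathcal E_n=\{e_0^{(n)},\dots,e^{(n)}_{2^n-1}\}$, $\mathcal E_n'=\mathcal E_n\setminus\{e_0\}$, $\mathcal E_n''=\mathcal E_n\setminus\{e_0,\tilde e_0\}$, $\pm X=X\cup(-X)$. $Z_e'(\mathcal A_{n+1})$ is the set of zero divisors of $\mathcal A_{n+1}$ of the form $(x,y)$ with $x\in\mathcal E_n'$, $y\in\pm\mathcal E_n$; zero divisors are considered up to multiplication by $\pm1$. Elements $x,y$ are orthogonal if $xy=yx=0$. $\Gamma_e(\mathcal A_{n+1})$ is the graph whose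 vertices are the lines $\mathbb R x$, $x\in Z_e'(\mathcal A_{n+1})$, distinct vertices being adjacent iff they are orthogonal (an element is identified with its line). A zero divisor is a nonzero $x$ with $xy=0$ or $yx=0$ for some $y\neq0$. *)

theory Defs
  imports "HOL-Analysis.Analysis" "HOL-Analysis.Finite_Function_Topology"
begin

text \<open>
  All the algebras \<open>\<A>\<^sub>0 \<subseteq> \<A>\<^sub>1 \<subseteq> \<dots>\<close> live inside the real vector space of finitely supported
  sequences: \<open>\<A>\<^sub>k\<close> consists of the sequences supported on \<open>{0..<2^k}\<close>, and a pair
  \<open>(a, b) \<in> \<A>\<^sub>k \<times> \<A>\<^sub>k = \<A>\<^sub>k\<^sub>+\<^sub>1\<close> is the concatenation of the coordinates of \<open>a\<close> and \<open>b\<close>.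
  Thus \<open>a \<in> \<A>\<^sub>k\<close> is identified with \<open>(a, 0) \<in> \<A>\<^sub>k\<^sub>+\<^sub>1\<close>, and the basis element \<open>e\<^sub>j\<close> does not
  depend on the level. The lemmas below give the recursive description of the algebras in terms
  of pairs. The ring multiplication that the library puts on the type \<open>poly_mapping\<close> plays no role.
\<close>

type_synonym cd = "nat \<Rightarrow>\<^sub>0 real"

definition cd_carrier :: "nat \<Rightarrow> cd set" where
  "cd_carrier k = {x. Poly_Mapping.keys x \<subseteq> {..<2 ^ k}}"

definition cd_pair :: "nat \<Rightarrow> cd \<Rightarrow> cd \<Rightarrow> cd" where
  "cd_pair k a b =
     (\<Sum>i<2 ^ k. Poly_Mapping.single i (Poly_Mapping.lookup a i)) +
     (\<Sum>i<2 ^ k. Poly_Mapping.single (2 ^ k + i) (Poly_Mapping.lookup b i))"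

definition cd_fst :: "nat \<Rightarrow> cd \<Rightarrow> cd" where
  "cd_fst k x = (\<Sum>i<2 ^ k. Poly_Mapping.single i (Poly_Mapping.lookup x i))"

definition cd_snd :: "nat \<Rightarrow> cd \<Rightarrow> cd" where
  "cd_snd k x = (\<Sum>i<2 ^ k. Poly_Mapping.single i (Poly_Mapping.lookup x (2 ^ k + i)))"

primrec cd_conj :: "nat \<Rightarrow> cd \<Rightarrow> cd" where
  "cd_conj 0 x = x"
| "cd_conj (Suc k) x = cd_pair k (cd_conj k (cd_fst k x)) (- cd_snd k x)"

primrec cd_mult :: "(nat \<Rightarrow> real) \<Rightarrow> nat \<Rightarrow> cd \<Rightarrow> cd \<Rightarrow> cd" where
  "cd_mult \<gamma> 0 x y =
     Poly_Mapping.single 0 (Poly_Mapping.lookup x 0 * Poly_Mapping.lookup y 0)"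
| "cd_mult \<gamma> (Suc k) x y =
     (let a = cd_fst k x; b = cd_snd k x; c = cd_fst k y; d = cd_snd k y in
      cd_pair k
        (cd_mult \<gamma> k a c + \<gamma> k *\<^sub>R cd_mult \<gamma> k (cd_conj k d) b)
        (cd_mult \<gamma> k d a + cd_mult \<gamma> k b (cd_conj k c)))"

definition cd_e :: "nat \<Rightarrow> cd" where
  "cd_e j = Poly_Mapping.single j 1"

text \<open>
  The real numbers \<open>n(a) = a a\<^sup>*\<close> and \<open>\<langle>a, b\<rangle> = (a b\<^sup>* + b a\<^sup>*) / 2\<close> (star: the involution) are read off as coefficients of
  the unity \<open>e\<^sub>0\<close>; the lemmas \<open>cd_norm\<close> and \<open>cd_form\<close> below show that the other coefficients
  vanish.
\<close>

definition cd_norm :: "(nat \<Rightarrow> real) \<Rightarrow> nat \<Rightarrow> cd \<Rightarrow> real" where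
  "cd_norm \<gamma> k a = Poly_Mapping.lookup (cd_mult \<gamma> k a (cd_conj k a)) 0"

definition cd_form :: "(nat \<Rightarrow> real) \<Rightarrow> nat \<Rightarrow> cd \<Rightarrow> cd \<Rightarrow> real" where
  "cd_form \<gamma> k a b = Poly_Mapping.lookup
     ((1 / 2) *\<^sub>R (cd_mult \<gamma> k a (cd_conj k b) + cd_mult \<gamma> k b (cd_conj k a))) 0"

definition cd_perp :: "(nat \<Rightarrow> real) \<Rightarrow> nat \<Rightarrow> cd \<Rightarrow> cd set \<Rightarrow> bool" where
  "cd_perp \<gamma> k a S \<longleftrightarrow> (\<forall>h\<in>S. cd_form \<gamma> k a h = 0)"

text \<open>\<open>\<chi>((x, y)) = \<gamma>\<^sub>n n(x) / n(y)\<close> for an element \<open>(x, y)\<close> of \<open>\<A>\<^sub>n\<^sub>+\<^sub>1\<close>.\<close>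

definition cd_chi :: "(nat \<Rightarrow> real) \<Rightarrow> nat \<Rightarrow> cd \<Rightarrow> real" where
  "cd_chi \<gamma> n z = \<gamma> n * (cd_norm \<gamma> n (cd_fst n z) / cd_norm \<gamma> n (cd_snd n z))"

text \<open>The element \<open>(0, e\<^sub>0)\<close> of \<open>\<A>\<^sub>n\<close>, see lemma \<open>cd_te0\<close> below; meaningful for \<open>n \<ge> 1\<close> only.\<close>

definition cd_te0 :: "nat \<Rightarrow> cd" where
  "cd_te0 n = cd_e (2 ^ (n - 1))"

definition cd_tilde :: "(nat \<Rightarrow> real) \<Rightarrow> nat \<Rightarrow> cd \<Rightarrow> cd" where
  "cd_tilde \<gamma> n x = cd_mult \<gamma> n x (cd_te0 n)"

definition cd_E :: "nat \<Rightarrow> cd set" where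
  "cd_E n = cd_e ` {..<2 ^ n}"

definition cd_E' :: "nat \<Rightarrow> cd set" where
  "cd_E' n = cd_E n - {cd_e 0}"

definition cd_E'' :: "nat \<Rightarrow> cd set" where
  "cd_E'' n = cd_E n - {cd_e 0, cd_te0 n}"

definition cd_pm :: "cd set \<Rightarrow> cd set" where
  "cd_pm X = X \<union> uminus ` X"

definition cd_zero_divisor :: "(nat \<Rightarrow> real) \<Rightarrow> nat \<Rightarrow> cd \<Rightarrow> bool" where
  "cd_zero_divisor \<gamma> k x \<longleftrightarrow> x \<in> cd_carrier k \<and> x \<noteq> 0 \<and>
     (\<exists>y\<in>cd_carrier k. y \<noteq> 0 \<and> (cd_mult \<gamma> k x y = 0 \<or> cd_mult \<gamma> k y x = 0))"

definition cd_orth :: "(nat \<Rightarrow> real) \<Rightarrow> nat \<Rightarrow> cd \<Rightarrow> cd \<Rightarrow> bool" where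
  "cd_orth \<gamma> k x y \<longleftrightarrow> cd_mult \<gamma> k x y = 0 \<and> cd_mult \<gamma> k y x = 0"

text \<open>In the next three definitions the argument \<open>n\<close> refers to the algebra \<open>\<A>\<^sub>n\<^sub>+\<^sub>1\<close>.\<close>

definition cd_Ze' :: "(nat \<Rightarrow> real) \<Rightarrow> nat \<Rightarrow> cd set" where
  "cd_Ze' \<gamma> n = {cd_pair n x y | x y.
     x \<in> cd_E' n \<and> y \<in> cd_pm (cd_E n) \<and> cd_zero_divisor \<gamma> (Suc n) (cd_pair n x y)}"

text \<open>The graph \<open>\<Gamma>\<^sub>e(\<A>\<^sub>n\<^sub>+\<^sub>1)\<close>: its vertices are the lines \<open>\<real>x = span {x}\<close>, its edges are
  two-element sets of vertices.\<close>

definition cd_vertices :: "(nat \<Rightarrow> real) \<Rightarrow> nat \<Rightarrow> cd set set" where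
  "cd_vertices \<gamma> n = {span {x} | x. x \<in> cd_Ze' \<gamma> n}"

definition cd_edges :: "(nat \<Rightarrow> real) \<Rightarrow> nat \<Rightarrow> cd set set set" where
  "cd_edges \<gamma> n = {{span {x}, span {y}} | x y.
     x \<in> cd_Ze' \<gamma> n \<and> y \<in> cd_Ze' \<gamma> n \<and> span {x} \<noteq> span {y} \<and> cd_orth \<gamma> (Suc n) x y}"

subsection \<open>The recursive description of the algebras\<close>

lemma lookup_scaleR [simp]:
  "Poly_Mapping.lookup (r *\<^sub>R (x :: cd)) i = r * Poly_Mapping.lookup x i"
proof -
  have "finite {i. r * Poly_Mapping.lookup x i \<noteq> 0}"
    by (rule finite_subset[OF _ finite_keys[of x]]) (auto simp: in_keys_iff)
  then show ?thesis
    by (simp add: scaleR_poly_mapping_def Abs_poly_mapping_inverse)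
qed

lemma lookup_sum_single:
  "Poly_Mapping.lookup (\<Sum>i<(m::nat). Poly_Mapping.single (d + i) (f i :: real)) j =
     (if d \<le> j \<and> j < d + m then f (j - d) else 0)"
  by (induction m) (auto simp: lookup_add lookup_single when_def less_Suc_eq)

lemma lookup_cd_fst:
  "Poly_Mapping.lookup (cd_fst k x) j = (if j < 2 ^ k then Poly_Mapping.lookup x j else 0)"
  using lookup_sum_single[of 0 "\<lambda>i. Poly_Mapping.lookup x i" "2 ^ k" j]
  by (simp add: cd_fst_def)

lemma lookup_cd_snd:
  "Poly_Mapping.lookup (cd_snd k x) j =
     (if j < 2 ^ k then Poly_Mapping.lookup x (2 ^ k + j) else 0)"
  using lookup_sum_single[of 0 "\<lambda>i. Poly_Mapping.lookup x (2 ^ k + i)" "2 ^ k" j]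
  by (simp add: cd_snd_def)

lemma lookup_cd_pair:
  "Poly_Mapping.lookup (cd_pair k a b) j =
     (if j < 2 ^ k then Poly_Mapping.lookup a j
      else if j < 2 ^ Suc k then Poly_Mapping.lookup b (j - 2 ^ k) else 0)"
  using lookup_sum_single[of 0 "\<lambda>i. Poly_Mapping.lookup a i" "2 ^ k" j]
        lookup_sum_single[of "2 ^ k" "\<lambda>i. Poly_Mapping.lookup b i" "2 ^ k" j]
  by (auto simp: cd_pair_def lookup_add)

lemma cd_carrier_iff:
  "x \<in> cd_carrier k \<longleftrightarrow> (\<forall>j\<ge>2 ^ k. Poly_Mapping.lookup x j = 0)"
  by (simp add: cd_carrier_def subset_iff in_keys_iff) (metis linorder_not_less)

lemma cd_carrier_0: "cd_carrier 0 = range (\<lambda>r. r *\<^sub>R cd_e 0)"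
proof (intro equalityI subsetI)
  fix x assume "x \<in> cd_carrier 0"
  then have "x = Poly_Mapping.lookup x 0 *\<^sub>R cd_e 0"
    by (intro poly_mapping_eqI) (auto simp: cd_carrier_iff cd_e_def lookup_one when_def)
  then show "x \<in> range (\<lambda>r. r *\<^sub>R cd_e 0)" by blast
qed (auto simp: cd_carrier_iff cd_e_def lookup_one when_def)

lemma cd_fst_carrier [simp]: "cd_fst k x \<in> cd_carrier k"
  and cd_snd_carrier [simp]: "cd_snd k x \<in> cd_carrier k"
  and cd_pair_carrier [simp]: "cd_pair k a b \<in> cd_carrier (Suc k)"
  by (auto simp: cd_carrier_iff lookup_cd_fst lookup_cd_snd lookup_cd_pair)

lemma cd_fst_pair [simp]: "a \<in> cd_carrier k \<Longrightarrow> cd_fst k (cd_pair k a b) = a"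
  and cd_snd_pair [simp]: "b \<in> cd_carrier k \<Longrightarrow> cd_snd k (cd_pair k a b) = b"
  and cd_pair_fst_snd: "x \<in> cd_carrier (Suc k) \<Longrightarrow> cd_pair k (cd_fst k x) (cd_snd k x) = x"
  by (auto intro!: poly_mapping_eqI
      simp: cd_carrier_iff lookup_cd_fst lookup_cd_snd lookup_cd_pair)

lemma cd_carrier_Suc:
  "bij_betw (\<lambda>(a, b). cd_pair k a b) (cd_carrier k \<times> cd_carrier k) (cd_carrier (Suc k))"
  by (rule bij_betwI[where g = "\<lambda>x. (cd_fst k x, cd_snd k x)"])
     (auto simp: cd_pair_fst_snd)

lemma cd_pair_add: "cd_pair k a b + cd_pair k c d = cd_pair k (a + c) (b + d)"
  and cd_pair_scaleR: "r *\<^sub>R cd_pair k a b = cd_pair k (r *\<^sub>R a) (r *\<^sub>R b)"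
  and cd_pair_uminus: "- cd_pair k a b = cd_pair k (- a) (- b)"
  by (auto intro!: poly_mapping_eqI simp: lookup_cd_pair lookup_add)

lemma cd_pair_zero: "a \<in> cd_carrier k \<Longrightarrow> cd_pair k a 0 = a"
  by (auto intro!: poly_mapping_eqI simp: cd_carrier_iff lookup_cd_pair)

lemma cd_conj_pair:
  "a \<in> cd_carrier k \<Longrightarrow> b \<in> cd_carrier k \<Longrightarrow>
     cd_conj (Suc k) (cd_pair k a b) = cd_pair k (cd_conj k a) (- b)"
  by simp

lemma cd_mult_pair:
  assumes "a \<in> cd_carrier k" "b \<in> cd_carrier k" "c \<in> cd_carrier k" "d \<in> cd_carrier k"
  shows "cd_mult \<gamma> (Suc k) (cd_pair k a b) (cd_pair k c d) =
    cd_pair k (cd_mult \<gamma> k a c + \<gamma> k *\<^sub>R cd_mult \<gamma> k (cd_conj k d) b)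
              (cd_mult \<gamma> k d a + cd_mult \<gamma> k b (cd_conj k c))"
  using assms by simp

lemma cd_e_lower: "j < 2 ^ k \<Longrightarrow> cd_e j = cd_pair k (cd_e j) 0"
  and cd_e_upper: "2 ^ k \<le> j \<Longrightarrow> j < 2 ^ Suc k \<Longrightarrow> cd_e j = cd_pair k 0 (cd_e (j - 2 ^ k))"
  by (auto intro!: poly_mapping_eqI simp: cd_e_def lookup_cd_pair lookup_single when_def)

lemma cd_te0: "n \<ge> 1 \<Longrightarrow> cd_te0 n = cd_pair (n - 1) 0 (cd_e 0)"
  using cd_e_upper[of "n - 1" "2 ^ (n - 1)"] by (simp add: cd_te0_def)

lemma linear_cd_fst: "linear (cd_fst k)" and linear_cd_snd: "linear (cd_snd k)"
  by (auto intro!: linearI poly_mapping_eqI simp: lookup_cd_fst lookup_cd_snd lookup_add)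

lemma linear_cd_conj: "linear (cd_conj k)"
proof (induction k)
  case 0
  then show ?case by (auto intro: linearI)
next
  case (Suc k)
  then show ?case
    by (intro linearI)
       (simp_all add: linear_add[OF linear_cd_fst] linear_add[OF linear_cd_snd]
         linear_scale[OF linear_cd_fst] linear_scale[OF linear_cd_snd]
         linear_add[OF Suc] linear_scale[OF Suc] cd_pair_add cd_pair_scaleR)
qed

lemma cd_conj_carrier [simp]: "x \<in> cd_carrier k \<Longrightarrow> cd_conj k x \<in> cd_carrier k"
  by (cases k) auto

lemma cd_conj_conj: "x \<in> cd_carrier k \<Longrightarrow> cd_conj k (cd_conj k x) = x"
proof (induction k arbitrary: x)
  case (Suc k)
  have "- cd_snd k x \<in> cd_carrier k"
    using cd_snd_carrier[of k x] by (simp add: cd_carrier_iff)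
  with Suc show ?case
    by (simp add: cd_pair_fst_snd)
qed simp

lemma bilinear_cd_mult: "bilinear (cd_mult \<gamma> k)"
proof (induction k)
  case 0
  show ?case
    by (auto simp: bilinear_def lookup_add algebra_simps single_add[symmetric]
        intro!: linearI poly_mapping_eqI)
       (auto simp: lookup_single when_def)
next
  case (Suc k)
  note s = linear_add[OF linear_cd_fst] linear_add[OF linear_cd_snd]
    linear_scale[OF linear_cd_fst] linear_scale[OF linear_cd_snd]
    linear_add[OF linear_cd_conj] linear_scale[OF linear_cd_conj]
    bilinear_ladd[OF Suc] bilinear_radd[OF Suc] bilinear_lmul[OF Suc] bilinear_rmul[OF Suc]
  show ?case
    unfolding bilinear_def
    by (auto simp: Let_def s cd_pair_add cd_pair_scaleR algebra_simps intro!: linearI)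
qed

lemma cd_mult_conj_real:
  assumes "a \<in> cd_carrier k"
  shows "\<exists>r. cd_mult \<gamma> k a (cd_conj k a) = r *\<^sub>R cd_e 0 \<and> cd_mult \<gamma> k (cd_conj k a) a = r *\<^sub>R cd_e 0"
  using assms
proof (induction k arbitrary: a)
  case 0
  show ?case
    by (rule exI[of _ "Poly_Mapping.lookup a 0 * Poly_Mapping.lookup a 0"])
       (auto intro!: poly_mapping_eqI simp: cd_e_def lookup_single lookup_one when_def)
next
  case (Suc k)
  define u v where "u = cd_fst k a" and "v = cd_snd k a"
  have uv [simp]: "u \<in> cd_carrier k" "v \<in> cd_carrier k" "- v \<in> cd_carrier k"
    by (auto simp: u_def v_def)
       (use cd_snd_carrier[of k a] in \<open>simp add: cd_carrier_iff\<close>)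
  have a: "a = cd_pair k u v"
    using Suc.prems by (simp add: u_def v_def cd_pair_fst_snd)
  obtain r where r: "cd_mult \<gamma> k u (cd_conj k u) = r *\<^sub>R cd_e 0"
      "cd_mult \<gamma> k (cd_conj k u) u = r *\<^sub>R cd_e 0"
    using Suc.IH[OF uv(1)] by blast
  obtain s where s: "cd_mult \<gamma> k (cd_conj k v) v = s *\<^sub>R cd_e 0"
    using Suc.IH[OF uv(2)] by blast
  have neg: "cd_mult \<gamma> k (- x) y = - cd_mult \<gamma> k x y" "cd_mult \<gamma> k x (- y) = - cd_mult \<gamma> k x y"
    "cd_conj k (- x) = - cd_conj k x" for x y
    by (rule bilinear_lneg bilinear_cd_mult bilinear_rneg linear_neg linear_cd_conj)+
  have e: "cd_pair k ((t::real) *\<^sub>R cd_e 0) 0 = t *\<^sub>R cd_e 0" for t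
    by (rule cd_pair_zero) (auto simp: cd_carrier_iff cd_e_def lookup_one when_def)
  have *: "r *\<^sub>R cd_e 0 - (\<gamma> k * s) *\<^sub>R cd_e 0 = (r - \<gamma> k * s) *\<^sub>R cd_e 0"
    by (simp add: algebra_simps)
  show ?case
    by (rule exI[of _ "r - \<gamma> k * s"])
       (simp add: a neg r s cd_conj_conj * e del: add_uminus_conv_diff
         flip: diff_conv_add_uminus)
qed

lemma cd_norm: "a \<in> cd_carrier k \<Longrightarrow> cd_mult \<gamma> k a (cd_conj k a) = cd_norm \<gamma> k a *\<^sub>R cd_e 0"
  using cd_mult_conj_real[of a k \<gamma>] by (auto simp: cd_norm_def cd_e_def)

lemma cd_form:
  assumes "a \<in> cd_carrier k" "b \<in> cd_carrier k"
  shows "(1 / 2) *\<^sub>R (cd_mult \<gamma> k a (cd_conj k b) + cd_mult \<gamma> k b (cd_conj k a)) =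
    cd_form \<gamma> k a b *\<^sub>R cd_e 0"
proof -
  let ?N = "\<lambda>x. cd_mult \<gamma> k x (cd_conj k x)"
  have "a + b \<in> cd_carrier k"
    using assms by (simp add: cd_carrier_iff lookup_add)
  note N = this[THEN cd_norm, of \<gamma>] assms[THEN cd_norm, of \<gamma>]
  have "cd_mult \<gamma> k a (cd_conj k b) + cd_mult \<gamma> k b (cd_conj k a) = ?N (a + b) - ?N a - ?N b"
    by (simp add: linear_add[OF linear_cd_conj] bilinear_ladd[OF bilinear_cd_mult]
        bilinear_radd[OF bilinear_cd_mult])
  also have "\<dots> = (cd_norm \<gamma> k (a + b) - cd_norm \<gamma> k a - cd_norm \<gamma> k b) *\<^sub>R cd_e 0"
    by (simp only: N scaleR_left_diff_distrib)
  finally show ?thesis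
    by (simp add: cd_form_def cd_e_def)
qed

end

theory Submission
  imports Defs
begin

text \<open>
  Write \<open>t = (0, e\<^sub>0)\<close> and \<open>u = c t\<close>. Orthogonality of \<open>(a, b)\<close> to \<open>(c, t)\<close> or to \<open>(t, \<gamma>\<^sub>n c)\<close> is a
  system of equations between signed basis elements, which multiply alternatively, \<open>x (x y) = x\<^sup>2 y\<close>,
  and of which distinct imaginary ones anticommute. If \<open>a\<close> lies in \<open>H = {\<plusminus>e\<^sub>0, \<plusminus>c, \<plusminus>t, \<plusminus>u}\<close>, then \<open>b\<close> can be solved for, and the system
  is consistent only if \<open>\<chi> = 1\<close>. If \<open>a\<close> lies outside \<open>H\<close>, both systems become \<open>b c = t a\<close>,
  \<open>c a = \<gamma>\<^sub>n b t\<close>; the identity \<open>(c a) t = (a t) c\<close> turns these into \<open>b = - c\<^sup>2 (c a) t\<close> and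
  \<open>b = \<gamma>\<^sub>n \<gamma>\<^sub>n\<^sub>-\<^sub>1 (c a) t\<close>, so that the system is inconsistent if \<open>\<chi> = 1\<close>, whereas for \<open>\<chi> = - 1\<close> both
  equations amount to \<open>a b = \<gamma>\<^sub>n\<^sub>-\<^sub>1 n(b) u\<close>. For \<open>n \<ge> 3\<close> there is a basis element outside \<open>H\<close>; for
  \<open>n = 2\<close> the associativity of \<open>\<A>\<^sub>2\<close> excludes annihilators of \<open>(c, t)\<close> and \<open>(t, \<gamma>\<^sub>n c)\<close>.
\<close>

section \<open>Signed basis elements\<close>

lemmas cd_mult_bilin [simp] =
  bilinear_ladd[OF bilinear_cd_mult] bilinear_radd[OF bilinear_cd_mult]
  bilinear_lmul[OF bilinear_cd_mult] bilinear_rmul[OF bilinear_cd_mult]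
  bilinear_lneg[OF bilinear_cd_mult] bilinear_rneg[OF bilinear_cd_mult]
  bilinear_lzero[OF bilinear_cd_mult] bilinear_rzero[OF bilinear_cd_mult]
  bilinear_lsub[OF bilinear_cd_mult] bilinear_rsub[OF bilinear_cd_mult]

lemmas cd_conj_linear [simp] =
  linear_add[OF linear_cd_conj] linear_scale[OF linear_cd_conj]
  linear_neg[OF linear_cd_conj] linear_0[OF linear_cd_conj] linear_diff[OF linear_cd_conj]

text \<open>Unfolding the recursion on arbitrary arguments would introduce the projections
  \<open>cd_fst\<close> and \<open>cd_snd\<close>. Products and conjugates are computed on explicit
  pairs instead, by \<open>cd_mult_pair\<close> and \<open>cd_conj_pair\<close>.\<close>

declare cd_mult.simps(2) [simp del] cd_conj.simps(2) [simp del]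
declare cd_conj_conj [simp] cd_mult_pair [simp] cd_conj_pair [simp]

lemma cd_carrier_closed [simp]:
  "0 \<in> cd_carrier k"
  "x \<in> cd_carrier k \<Longrightarrow> y \<in> cd_carrier k \<Longrightarrow> x + y \<in> cd_carrier k"
  "x \<in> cd_carrier k \<Longrightarrow> y \<in> cd_carrier k \<Longrightarrow> x - y \<in> cd_carrier k"
  "x \<in> cd_carrier k \<Longrightarrow> - x \<in> cd_carrier k"
  "x \<in> cd_carrier k \<Longrightarrow> r *\<^sub>R x \<in> cd_carrier k"
  by (auto simp: cd_carrier_iff lookup_add lookup_minus)

lemma cd_mult_carrier [simp]: "cd_mult \<gamma> k x y \<in> cd_carrier k"
proof (cases k)
  case 0
  then show ?thesis by (auto simp: cd_carrier_iff lookup_single when_def)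
qed (simp add: cd_mult.simps(2) Let_def)

lemma cd_e_carrier [simp]: "j < 2 ^ k \<Longrightarrow> cd_e j \<in> cd_carrier k"
  by (auto simp: cd_carrier_iff cd_e_def lookup_single when_def)

lemma cd_pair_eq_iff:
  assumes "a \<in> cd_carrier k" "b \<in> cd_carrier k" "c \<in> cd_carrier k" "d \<in> cd_carrier k"
  shows "cd_pair k a b = cd_pair k c d \<longleftrightarrow> a = c \<and> b = d"
  using assms by (metis cd_fst_pair cd_snd_pair)

lemma cd_pair_0 [simp]: "cd_pair k 0 0 = 0"
  by (rule cd_pair_zero) simp

lemma cd_pair_eq_0_iff:
  "a \<in> cd_carrier k \<Longrightarrow> b \<in> cd_carrier k \<Longrightarrow> cd_pair k a b = 0 \<longleftrightarrow> a = 0 \<and> b = 0"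
  using cd_pair_eq_iff[of a k b 0 0] by simp

lemma cd_carrier_SucE:
  assumes "x \<in> cd_carrier (Suc k)"
  obtains a b where "a \<in> cd_carrier k" "b \<in> cd_carrier k" "x = cd_pair k a b"
  using assms cd_pair_fst_snd[of x k] cd_fst_carrier cd_snd_carrier by metis

lemma cd_e_SucE:
  assumes "j < 2 ^ Suc k"
  obtains (lower) i where "i < 2 ^ k" "j = i" "cd_e j = cd_pair k (cd_e i) 0"
  | (upper) i where "i < 2 ^ k" "j = 2 ^ k + i" "cd_e j = cd_pair k 0 (cd_e i)"
proof (cases "j < 2 ^ k")
  case True
  then show ?thesis using cd_e_lower lower by blast
next
  case False
  with assms show ?thesis
    using upper[of "j - 2 ^ k"] cd_e_upper[of k j] by simp
qed

lemma cd_e_neq [simp]: "cd_e i \<noteq> 0" "cd_e i = cd_e j \<longleftrightarrow> i = j"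
    "cd_e i \<noteq> - cd_e j" "- cd_e j \<noteq> cd_e i"
  by (auto simp: cd_e_def poly_mapping_eq_iff fun_eq_iff lookup_single when_def split: if_splits)

section \<open>Conjugation, alternativity and anticommutation of basis elements\<close>

lemma cd_conj_e0 [simp]: "cd_conj k (cd_e 0) = cd_e 0"
proof (induction k)
  case (Suc k)
  show ?case
    by (subst (1 2) cd_e_lower[of 0 k]) (simp_all add: Suc)
qed simp

lemma cd_conj_e: "0 < j \<Longrightarrow> j < 2 ^ k \<Longrightarrow> cd_conj k (cd_e j) = - cd_e j"
proof (induction k arbitrary: j)
  case (Suc k)
  from Suc.prems(2) show ?case
  proof (cases rule: cd_e_SucE)
    case (lower i)
    then show ?thesis
      unfolding lower(3) using Suc.IH[of i] Suc.prems(1) by (simp add: cd_pair_uminus)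
  next
    case (upper i)
    then show ?thesis by (simp add: cd_pair_uminus)
  qed
qed simp

lemma cd_mult_conj:
  "x \<in> cd_carrier k \<Longrightarrow> y \<in> cd_carrier k \<Longrightarrow>
     cd_conj k (cd_mult \<gamma> k x y) = cd_mult \<gamma> k (cd_conj k y) (cd_conj k x)"
proof (induction k arbitrary: x y)
  case 0
  then show ?case by (simp add: mult.commute)
next
  case (Suc k)
  from Suc.prems show ?case
    by (elim cd_carrier_SucE) (simp add: Suc.IH add.commute)
qed

lemma cd_mult_e0 [simp]:
  assumes "x \<in> cd_carrier k"
  shows "cd_mult \<gamma> k (cd_e 0) x = x" "cd_mult \<gamma> k x (cd_e 0) = x"
proof -
  have "cd_mult \<gamma> k (cd_e 0) x = x \<and> cd_mult \<gamma> k x (cd_e 0) = x"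
    using assms
  proof (induction k arbitrary: x)
    case 0
    then show ?case
      by (auto simp: cd_carrier_iff cd_e_def lookup_single when_def intro!: poly_mapping_eqI)
  next
    case (Suc k)
    from Suc.prems obtain a b where ab: "a \<in> cd_carrier k" "b \<in> cd_carrier k" "x = cd_pair k a b"
      by (rule cd_carrier_SucE)
    then have "cd_mult \<gamma> (Suc k) (cd_pair k (cd_e 0) 0) x = x \<and>
        cd_mult \<gamma> (Suc k) x (cd_pair k (cd_e 0) 0) = x"
      by (simp add: Suc.IH)
    then show ?case by (simp flip: cd_e_lower)
  qed
  then show "cd_mult \<gamma> k (cd_e 0) x = x" "cd_mult \<gamma> k x (cd_e 0) = x" by auto
qed

lemma cd_e_conj_cases: "j < 2 ^ k \<Longrightarrow> cd_conj k (cd_e j) = cd_e j \<or> cd_conj k (cd_e j) = - cd_e j"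
  by (cases "j = 0") (simp_all add: cd_conj_e)

text \<open>Induction over the doubling. The left and right identities are proved together because
  left multiplication by \<open>(e_i, 0)\<close> acts on the second half as right multiplication by
  \<open>e_i\<close>. The sign is inherited for \<open>(e_i, 0)\<close>; for \<open>(0, e_i)\<close>
  it is multiplied by \<open>\<gamma> k\<close> and by the sign of \<open>e_i\<close> under
  conjugation.\<close>

lemma cd_e_alternative:
  assumes \<gamma>: "\<And>k. \<gamma> k \<in> {1, -1::real}" and "j < 2 ^ k"
  shows "\<exists>s\<in>{1,-1}. \<forall>x\<in>cd_carrier k.
    cd_mult \<gamma> k (cd_e j) (cd_mult \<gamma> k (cd_e j) x) = s *\<^sub>R x \<and>
    cd_mult \<gamma> k (cd_mult \<gamma> k x (cd_e j)) (cd_e j) = s *\<^sub>R x"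
  using assms(2)
proof (induction k arbitrary: j)
  case 0
  then have "j = 0" by simp
  then show ?case
    using cd_mult_e0[of _ 0 \<gamma>] by (intro bexI[of _ 1]) (auto simp del: cd_mult.simps(1))
next
  case (Suc k)
  from Suc.prems show ?case
  proof (cases rule: cd_e_SucE)
    case (lower i)
    from Suc.IH[OF lower(1)] obtain s where s: "s \<in> {1,-1}" "\<forall>x\<in>cd_carrier k.
      cd_mult \<gamma> k (cd_e i) (cd_mult \<gamma> k (cd_e i) x) = s *\<^sub>R x \<and>
      cd_mult \<gamma> k (cd_mult \<gamma> k x (cd_e i)) (cd_e i) = s *\<^sub>R x" by blast
    show ?thesis
      unfolding lower(3)
      by (intro bexI[OF _ s(1)] ballI, elim cd_carrier_SucE, use cd_e_conj_cases[OF lower(1)] in \<open>elim disjE\<close>)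
         (use lower(1) s(2) in \<open>simp_all add: cd_pair_scaleR\<close>)
  next
    case (upper i)
    from Suc.IH[OF upper(1)] obtain s where s: "s \<in> {1,-1}" "\<forall>x\<in>cd_carrier k.
      cd_mult \<gamma> k (cd_e i) (cd_mult \<gamma> k (cd_e i) x) = s *\<^sub>R x \<and>
      cd_mult \<gamma> k (cd_mult \<gamma> k x (cd_e i)) (cd_e i) = s *\<^sub>R x" by blast
    obtain s' where s': "s' \<in> {1,-1}" "cd_conj k (cd_e i) = s' *\<^sub>R cd_e i"
      using cd_e_conj_cases[OF upper(1)] by force
    have "s' * (\<gamma> k * s) \<in> {1,-1}"
      using s s' \<gamma>[of k] by auto
    then show ?thesis
      unfolding upper(3)
      by (intro bexI[of _ "s' * (\<gamma> k * s)"] ballI, elim cd_carrier_SucE)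
         (use upper(1) s(2) s'(2) in \<open>simp_all add: cd_pair_scaleR cd_mult_conj mult_ac\<close>)
  qed
qed

text \<open>Conjugating one factor lets the statement cover \<open>e_0\<close>, so the induction
  treats all indices alike. The second equation is the one to which products of two upper elements
  \<open>(0, e_i)\<close> reduce; mixed products of a lower and an upper element are compared
  directly.\<close>

lemma cd_e_anticomm:
  assumes "i < 2 ^ k" "j < 2 ^ k" "i \<noteq> j"
  shows "cd_mult \<gamma> k (cd_e i) (cd_conj k (cd_e j)) = - cd_mult \<gamma> k (cd_e j) (cd_conj k (cd_e i))
    \<and> cd_mult \<gamma> k (cd_conj k (cd_e i)) (cd_e j) = - cd_mult \<gamma> k (cd_conj k (cd_e j)) (cd_e i)"
  using assms
proof (induction k arbitrary: i j)
  case (Suc k)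
  from Suc.prems(1) show ?case
  proof (cases rule: cd_e_SucE)
    case i: (lower i')
    from Suc.prems(2) show ?thesis
    proof (cases rule: cd_e_SucE)
      case j: (lower j')
      have "i' \<noteq> j'" using i j Suc.prems(3) by simp
      from Suc.IH[OF i(1) j(1) this] show ?thesis
        unfolding i(3) j(3) using i(1) j(1) by (simp add: cd_pair_uminus)
    next
      case j: (upper j')
      show ?thesis
        unfolding i(3) j(3) using i(1) j(1) by (simp add: cd_pair_uminus)
    qed
  next
    case i: (upper i')
    from Suc.prems(2) show ?thesis
    proof (cases rule: cd_e_SucE)
      case j: (lower j')
      show ?thesis
        unfolding i(3) j(3) using i(1) j(1) by (simp add: cd_pair_uminus)
    next
      case j: (upper j')
      have "i' \<noteq> j'" using i j Suc.prems(3) by simp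
      from Suc.IH[OF i(1) j(1) this] show ?thesis
        unfolding i(3) j(3) using i(1) j(1) by (simp add: cd_pair_uminus)
    qed
  qed
qed auto

section \<open>Basis elements up to sign\<close>

lemma cd_pm_E_iff: "x \<in> cd_pm (cd_E k) \<longleftrightarrow> (\<exists>s\<in>{1,-1}. \<exists>j<2 ^ k. x = s *\<^sub>R cd_e j)"
  by (auto simp: cd_pm_def cd_E_def)

lemma cd_pm_EE:
  assumes "x \<in> cd_pm (cd_E k)"
  obtains s j where "s \<in> {1,-1::real}" "j < 2 ^ k" "x = s *\<^sub>R cd_e j"
  using assms unfolding cd_pm_E_iff by blast

lemma cd_pm_E_scale [simp]: "x \<in> cd_pm (cd_E k) \<Longrightarrow> s \<in> {1,-1::real} \<Longrightarrow> s *\<^sub>R x \<in> cd_pm (cd_E k)"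
  by (auto simp: cd_pm_def)

lemma cd_pm_E_minus [simp]: "- x \<in> cd_pm (cd_E k) \<longleftrightarrow> x \<in> cd_pm (cd_E k)"
  by (force simp: cd_pm_def image_iff)

lemma cd_pm_E_carrier [simp]: "x \<in> cd_pm (cd_E k) \<Longrightarrow> x \<in> cd_carrier k"
  by (auto elim!: cd_pm_EE)

lemma cd_pm_E_nonzero: "x \<in> cd_pm (cd_E k) \<Longrightarrow> x \<noteq> 0"
  by (auto elim!: cd_pm_EE)

lemma cd_pm_E_e [simp]: "j < 2 ^ k \<Longrightarrow> cd_e j \<in> cd_pm (cd_E k)"
  by (auto simp: cd_pm_def cd_E_def)

lemma cd_pm_E_SucE:
  assumes "x \<in> cd_pm (cd_E (Suc k))"
  obtains (lower) p where "p \<in> cd_pm (cd_E k)" "x = cd_pair k p 0"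
  | (upper) p where "p \<in> cd_pm (cd_E k)" "x = cd_pair k 0 p"
proof -
  from assms obtain s j where s: "s \<in> {1,-1::real}" "j < 2 ^ Suc k" "x = s *\<^sub>R cd_e j"
    by (rule cd_pm_EE)
  from s(2) show thesis
  proof (cases rule: cd_e_SucE)
    case (lower i)
    show ?thesis
      by (rule that(1)[of "s *\<^sub>R cd_e i"]) (use s(1) lower(1) in \<open>simp_all add: s(3) lower(3) cd_pair_scaleR\<close>)
  next
    case (upper i)
    show ?thesis
      by (rule that(2)[of "s *\<^sub>R cd_e i"]) (use s(1) upper(1) in \<open>simp_all add: s(3) upper(3) cd_pair_scaleR\<close>)
  qed
qed

lemma cd_pm_E_pair:
  assumes "p \<in> cd_pm (cd_E k)"
  shows "cd_pair k p 0 \<in> cd_pm (cd_E (Suc k))" "cd_pair k 0 p \<in> cd_pm (cd_E (Suc k))"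
proof -
  from assms obtain s j where s: "s \<in> {1,-1::real}" "j < 2 ^ k" "p = s *\<^sub>R cd_e j"
    by (rule cd_pm_EE)
  have "cd_pair k p 0 = s *\<^sub>R cd_e j"
    using s by (simp add: cd_pair_zero)
  moreover have "cd_pair k 0 p = s *\<^sub>R cd_e (2 ^ k + j)"
    using cd_e_upper[of k "2 ^ k + j"] s by (simp add: cd_pair_scaleR)
  ultimately show "cd_pair k p 0 \<in> cd_pm (cd_E (Suc k))" "cd_pair k 0 p \<in> cd_pm (cd_E (Suc k))"
    using s by simp_all
qed

lemma cd_pm_E_conj_real: "x \<in> {cd_e 0, - cd_e 0} \<Longrightarrow> cd_conj k x = x"
  by auto

lemma cd_pm_E_conj_imag:
  "x \<in> cd_pm (cd_E k) \<Longrightarrow> x \<notin> {cd_e 0, - cd_e 0} \<Longrightarrow> cd_conj k x = - x"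
  by (elim cd_pm_EE) (rename_tac s j, case_tac "j = 0", auto simp: cd_conj_e)

lemma cd_pm_E_conj [simp]: "x \<in> cd_pm (cd_E k) \<Longrightarrow> cd_conj k x \<in> cd_pm (cd_E k)"
  using cd_pm_E_conj_imag[of x k] cd_pm_E_conj_real[of x k] by (cases "x \<in> {cd_e 0, - cd_e 0}") auto

lemma cd_pm_E_anticomm_conj:
  assumes "x \<in> cd_pm (cd_E k)" "y \<in> cd_pm (cd_E k)" "x \<noteq> y" "x \<noteq> - y"
  shows "cd_mult \<gamma> k x (cd_conj k y) = - cd_mult \<gamma> k y (cd_conj k x)"
proof -
  obtain s i where x: "s \<in> {1,-1::real}" "i < 2 ^ k" "x = s *\<^sub>R cd_e i"
    using assms(1) by (rule cd_pm_EE)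
  obtain r j where y: "r \<in> {1,-1::real}" "j < 2 ^ k" "y = r *\<^sub>R cd_e j"
    using assms(2) by (rule cd_pm_EE)
  have "i \<noteq> j" using assms(3,4) x y by auto
  from cd_e_anticomm[OF x(2) y(2) this, of \<gamma>] show ?thesis
    by (simp add: x(3) y(3) mult.commute)
qed

lemma cd_pm_E_anticomm:
  assumes "x \<in> cd_pm (cd_E k)" "y \<in> cd_pm (cd_E k)" "x \<noteq> y" "x \<noteq> - y"
    "x \<notin> {cd_e 0, - cd_e 0}" "y \<notin> {cd_e 0, - cd_e 0}"
  shows "cd_mult \<gamma> k x y = - cd_mult \<gamma> k y x"
  using cd_pm_E_anticomm_conj[OF assms(1-4), of \<gamma>] assms
  by (simp add: cd_pm_E_conj_imag) (metis minus_minus)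

text \<open>For a signed basis element \<open>x\<close>, \<open>x x = cd_sq \<gamma> k x *\<^sub>R e\<^sub>0\<close>.\<close>

definition cd_sq :: "(nat \<Rightarrow> real) \<Rightarrow> nat \<Rightarrow> cd \<Rightarrow> real" where
  "cd_sq \<gamma> k x = Poly_Mapping.lookup (cd_mult \<gamma> k x x) 0"

section \<open>Squares, cancellation and products of signed basis elements\<close>

locale cd_params =
  fixes \<gamma> :: "nat \<Rightarrow> real"
  assumes \<gamma>: "\<gamma> k \<in> {1, -1}"
begin

lemma \<gamma>_mult [simp]: "\<gamma> k * \<gamma> k = 1" "\<gamma> k * (\<gamma> k * r) = r"
  using \<gamma>[of k] by auto

lemma \<gamma>_nonzero [simp]: "\<gamma> k \<noteq> 0"
  using \<gamma>[of k] by auto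

lemma cd_sq_exists:
  assumes "x \<in> cd_pm (cd_E k)"
  shows "cd_sq \<gamma> k x \<in> {1,-1} \<and> (\<forall>y\<in>cd_carrier k.
    cd_mult \<gamma> k x (cd_mult \<gamma> k x y) = cd_sq \<gamma> k x *\<^sub>R y \<and>
    cd_mult \<gamma> k (cd_mult \<gamma> k y x) x = cd_sq \<gamma> k x *\<^sub>R y)"
proof -
  obtain r i where x: "r \<in> {1,-1::real}" "i < 2 ^ k" "x = r *\<^sub>R cd_e i"
    using assms by (rule cd_pm_EE)
  have r: "r * r = 1" using x(1) by auto
  from cd_e_alternative[OF \<gamma> x(2)] obtain s where s: "s \<in> {1,-1}" "\<forall>y\<in>cd_carrier k.
      cd_mult \<gamma> k (cd_e i) (cd_mult \<gamma> k (cd_e i) y) = s *\<^sub>R y \<and>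
      cd_mult \<gamma> k (cd_mult \<gamma> k y (cd_e i)) (cd_e i) = s *\<^sub>R y"
    by (rule bexE)
  have *: "cd_mult \<gamma> k x (cd_mult \<gamma> k x y) = s *\<^sub>R y \<and>
      cd_mult \<gamma> k (cd_mult \<gamma> k y x) x = s *\<^sub>R y" if "y \<in> cd_carrier k" for y
    using bspec[OF s(2) that] by (simp add: x(3) r)
  \<comment> \<open>Testing the alternative law on the unity identifies the sign \<open>s\<close> as
    the square of \<open>x\<close>.\<close>
  have "cd_mult \<gamma> k x x = s *\<^sub>R cd_e 0"
    using *[of "cd_e 0"] assms by simp
  then have "cd_sq \<gamma> k x = s"
    by (simp add: cd_sq_def cd_e_def)
  then show ?thesis using s(1) * by simp
qed

lemma cd_sq_cases: "x \<in> cd_pm (cd_E k) \<Longrightarrow> cd_sq \<gamma> k x \<in> {1,-1}"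
  using cd_sq_exists by blast

lemma cd_sq_mult [simp]:
  assumes "x \<in> cd_pm (cd_E k)"
  shows "cd_sq \<gamma> k x * cd_sq \<gamma> k x = 1" "cd_sq \<gamma> k x * (cd_sq \<gamma> k x * r) = r" "cd_sq \<gamma> k x \<noteq> 0"
  using cd_sq_cases[OF assms] by auto

text \<open>These two rules stand in for associativity: a repeated factor can be removed at the cost
  of a sign.\<close>

lemma cd_alternative [simp]:
  assumes "x \<in> cd_pm (cd_E k)" "y \<in> cd_carrier k"
  shows "cd_mult \<gamma> k x (cd_mult \<gamma> k x y) = cd_sq \<gamma> k x *\<^sub>R y"
    "cd_mult \<gamma> k (cd_mult \<gamma> k y x) x = cd_sq \<gamma> k x *\<^sub>R y"
  using cd_sq_exists assms by blast+

lemma cd_mult_self [simp]: "x \<in> cd_pm (cd_E k) \<Longrightarrow> cd_mult \<gamma> k x x = cd_sq \<gamma> k x *\<^sub>R cd_e 0"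
  using cd_alternative(1)[of x k "cd_e 0"] by simp

text \<open>Multiplying once more by \<open>x\<close> turns both sides into the same nonzero
  multiple of \<open>y\<close> and \<open>z\<close>.\<close>

lemma cd_cancel:
  assumes "x \<in> cd_pm (cd_E k)" "y \<in> cd_carrier k" "z \<in> cd_carrier k"
  shows "cd_mult \<gamma> k x y = cd_mult \<gamma> k x z \<longleftrightarrow> y = z" "cd_mult \<gamma> k y x = cd_mult \<gamma> k z x \<longleftrightarrow> y = z"
proof -
  show "cd_mult \<gamma> k x y = cd_mult \<gamma> k x z \<longleftrightarrow> y = z"
    using cd_alternative(1)[OF assms(1,2)] cd_alternative(1)[OF assms(1,3)] cd_sq_mult(3)[OF assms(1)]
    by (metis scaleR_cancel_left)
  show "cd_mult \<gamma> k y x = cd_mult \<gamma> k z x \<longleftrightarrow> y = z"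
    using cd_alternative(2)[OF assms(1,2)] cd_alternative(2)[OF assms(1,3)] cd_sq_mult(3)[OF assms(1)]
    by (metis scaleR_cancel_left)
qed

lemma cd_pm_E_mult [simp]:
  "x \<in> cd_pm (cd_E k) \<Longrightarrow> y \<in> cd_pm (cd_E k) \<Longrightarrow> cd_mult \<gamma> k x y \<in> cd_pm (cd_E k)"
proof (induction k arbitrary: x y)
  case 0
  then show ?case
    by (auto elim!: cd_pm_EE simp: cd_pm_E_iff simp del: cd_mult.simps(1))
next
  case (Suc k)
  from Suc.prems(1) show ?case
    by (cases rule: cd_pm_E_SucE; use Suc.prems(2) in \<open>cases rule: cd_pm_E_SucE\<close>)
       (use \<gamma>[of k] in \<open>auto intro!: cd_pm_E_pair Suc.IH cd_pm_E_scale\<close>)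
qed

lemma cd_norm_imag:
  assumes "x \<in> cd_pm (cd_E k)" "x \<notin> {cd_e 0, - cd_e 0}"
  shows "cd_norm \<gamma> k x = - cd_sq \<gamma> k x"
  using assms by (simp add: cd_norm_def cd_pm_E_conj_imag cd_e_def)

end

section \<open>The subalgebra generated by two basis elements\<close>

context cd_params
begin

lemma cd_norm_cases:
  assumes "x \<in> cd_pm (cd_E k)"
  shows "cd_norm \<gamma> k x \<in> {1,-1}"
proof (cases "x \<in> {cd_e 0, - cd_e 0}")
  case True
  then have "cd_norm \<gamma> k x = 1"
    by (auto simp: cd_norm_def cd_mult_e0) (simp_all add: cd_e_def)
  then show ?thesis by simp
next
  case False
  then show ?thesis
    using cd_norm_imag[OF assms] cd_sq_cases[OF assms] by auto
qed

lemma cd_te0_Suc: "cd_te0 (Suc m) = cd_pair m 0 (cd_e 0)"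
  using cd_te0[of "Suc m"] by simp

lemma cd_te0_pm_E [simp]: "cd_te0 (Suc m) \<in> cd_pm (cd_E (Suc m))"
  by (simp add: cd_te0_def)

lemma cd_sq_te0: "cd_sq \<gamma> (Suc m) (cd_te0 (Suc m)) = \<gamma> m"
proof -
  have "cd_mult \<gamma> (Suc m) (cd_te0 (Suc m)) (cd_te0 (Suc m)) = \<gamma> m *\<^sub>R cd_e 0"
    by (simp add: cd_te0_Suc cd_pair_zero del: cd_mult_self)
  then show ?thesis by simp
qed

text \<open>Holds because the halves of \<open>a\<close> and \<open>c\<close> that do not vanish are distinct imaginary basis
  elements of \<open>\<A>\<^sub>m\<close> up to sign, hence anticommute.\<close>

lemma cd_mult_te0_swap:
  fixes m and a c :: cd
  defines "t \<equiv> cd_te0 (Suc m)"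
  assumes c: "c \<in> cd_pm (cd_E (Suc m))" "c \<notin> {cd_e 0, - cd_e 0, t, - t}"
    and a: "a \<in> cd_pm (cd_E (Suc m))" "a \<notin> {cd_e 0, - cd_e 0, t, - t}"
    and ac: "a \<noteq> c" "a \<noteq> - c" "a \<noteq> cd_mult \<gamma> (Suc m) c t" "a \<noteq> - cd_mult \<gamma> (Suc m) c t"
  shows "cd_mult \<gamma> (Suc m) (cd_mult \<gamma> (Suc m) c a) t = cd_mult \<gamma> (Suc m) (cd_mult \<gamma> (Suc m) a t) c"
proof -
  note t = t_def cd_te0_Suc
  \<comment> \<open>The nonzero half is not \<open>e_0\<close> up to sign, since
    \<open>(e_0, 0)\<close> is the unity and \<open>(0, e_0)\<close> is \<open>t\<close>.\<close>
  have imag: "p \<notin> {cd_e 0, - cd_e 0}"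
    if "x \<notin> {cd_e 0, - cd_e 0, t, - t}" "x = cd_pair m p 0 \<or> x = cd_pair m 0 p"
      "p \<in> cd_pm (cd_E m)" for x p
    using that by (auto simp: t cd_pair_uminus cd_pair_zero)
  obtain q where q: "q \<in> cd_pm (cd_E m)" "c = cd_pair m q 0 \<or> c = cd_pair m 0 q"
    using c(1) by (cases rule: cd_pm_E_SucE) auto
  obtain p where p: "p \<in> cd_pm (cd_E m)" "a = cd_pair m p 0 \<or> a = cd_pair m 0 p"
    using a(1) by (cases rule: cd_pm_E_SucE) auto
  note q' = imag[OF c(2) q(2,1)] and p' = imag[OF a(2) p(2,1)]
  have conj: "cd_conj m p = - p" "cd_conj m q = - q"
    using p q p' q' by (auto intro!: cd_pm_E_conj_imag)
  \<comment> \<open>Multiplication by \<open>t\<close> moves \<open>q\<close> to the other half, up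
    to sign. Hence \<open>p = q\<close> or \<open>p = - q\<close> would make \<open>a\<close> equal
    to \<open>c\<close> or \<open>c t\<close> up to sign.\<close>
  have "p \<noteq> q" "p \<noteq> - q"
    using ac p q \<gamma>[of m]
    by (auto simp: t cd_pair_uminus conj)
  then have "cd_mult \<gamma> m p q = - cd_mult \<gamma> m q p"
    using p q p' q' by (intro cd_pm_E_anticomm) auto
  then show ?thesis
    using p q by (auto simp: t conj cd_pair_uminus)
qed

end

section \<open>The eight-element set \<open>H\<close> of signed products of \<open>c\<close> and
  \<open>t\<close>\<close>

locale cd_doubled = cd_params +
  fixes m :: nat and c :: cd
  assumes c: "c \<in> cd_pm (cd_E'' (Suc m))"
begin

abbreviation n where "n \<equiv> Suc m"
abbreviation B where "B \<equiv> cd_pm (cd_E (Suc m))"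
abbreviation mul (infixl "\<odot>" 70) where "x \<odot> y \<equiv> cd_mult \<gamma> (Suc m) x y"
abbreviation t where "t \<equiv> cd_te0 (Suc m)"
abbreviation u where "u \<equiv> c \<odot> t"
abbreviation \<kappa> where "\<kappa> \<equiv> cd_sq \<gamma> (Suc m) c"
abbreviation v1 where "v1 \<equiv> cd_pair n c t"
abbreviation v2 where "v2 \<equiv> cd_pair n t (\<gamma> n *\<^sub>R c)"

text \<open>The basis of the subalgebra spanned by \<open>e_0\<close>, \<open>c\<close>,
  \<open>t\<close>, \<open>c t\<close>, taken with both signs, so that it is closed under
  multiplication (\<open>H_mult\<close>).\<close>

definition H where "H = {s *\<^sub>R h | s h. s \<in> {1,-1} \<and> h \<in> {cd_e 0, c, t, u}}"

lemma c_B [simp]: "c \<in> B"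
  using c by (auto simp: cd_pm_def cd_E''_def)

lemma c_neq: "c \<notin> {cd_e 0, - cd_e 0, t, - t}"
  using c by (auto simp: cd_pm_def cd_E''_def cd_E_def cd_te0_def)

lemma t_neq: "t \<noteq> cd_e 0" "t \<noteq> - cd_e 0"
  by (auto simp: cd_te0_def)

text \<open>If \<open>c t\<close> were one of these, writing that element as a product with right
  factor \<open>t\<close> or left factor \<open>c\<close> and cancelling would give a forbidden
  relation among \<open>c\<close>, \<open>t\<close> and \<open>e_0\<close>.\<close>

lemma u_neq: "u \<notin> {cd_e 0, - cd_e 0, c, - c, t, - t}"
proof -
  have "u \<noteq> s *\<^sub>R cd_e 0" if "s \<in> {1,-1}" for s
  proof
    assume "u = s *\<^sub>R cd_e 0"
    then have "u = ((s * \<gamma> m) *\<^sub>R t) \<odot> t" by (simp add: cd_sq_te0)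
    then have "c = (s * \<gamma> m) *\<^sub>R t" by (subst (asm) cd_cancel(2)) auto
    then show False using c_neq \<gamma>[of m] that by auto
  qed
  moreover have "u \<noteq> s *\<^sub>R c" if "s \<in> {1,-1}" for s
  proof
    assume "u = s *\<^sub>R c"
    then have "u = c \<odot> (s *\<^sub>R cd_e 0)" by simp
    then have "t = s *\<^sub>R cd_e 0" by (subst (asm) cd_cancel(1)) auto
    then show False using t_neq that by auto
  qed
  moreover have "u \<noteq> s *\<^sub>R t" if "s \<in> {1,-1}" for s
  proof
    assume "u = s *\<^sub>R t"
    then have "u = (s *\<^sub>R cd_e 0) \<odot> t" by simp
    then have "c = s *\<^sub>R cd_e 0" by (subst (asm) cd_cancel(2)) auto
    then show False using c_neq that by auto
  qed
  from calculation[of 1] calculation[of "-1"] this[of 1] this[of "-1"] show ?thesis by simp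
qed

lemma conj_ct [simp]: "cd_conj n c = - c" "cd_conj n t = - t" "cd_conj n u = - u"
  using c_neq t_neq u_neq by (simp_all add: cd_pm_E_conj_imag)

lemma tc: "t \<odot> c = - u"
  using c_neq t_neq cd_pm_E_anticomm[of c n t \<gamma>] by auto

text \<open>By \<open>t c = - u\<close>, the products \<open>t u\<close> and \<open>u c\<close>
  become \<open>- t (t c)\<close> and \<open>- (t c) c\<close>, which alternativity
  evaluates.\<close>

lemma table:
  "c \<odot> c = \<kappa> *\<^sub>R cd_e 0" "t \<odot> t = \<gamma> m *\<^sub>R cd_e 0" "c \<odot> u = \<kappa> *\<^sub>R t" "u \<odot> t = \<gamma> m *\<^sub>R c"
  "t \<odot> u = - (\<gamma> m *\<^sub>R c)" "u \<odot> c = - (\<kappa> *\<^sub>R t)"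
proof -
  show "t \<odot> u = - (\<gamma> m *\<^sub>R c)"
    using cd_alternative(1)[of t n c] by (simp add: tc cd_sq_te0 minus_equation_iff)
  show "u \<odot> c = - (\<kappa> *\<^sub>R t)"
    using cd_alternative(2)[of c n t] by (simp add: tc minus_equation_iff)
qed (simp_all add: cd_sq_te0)

lemma \<kappa>: "\<kappa> \<in> {1,-1}" "\<kappa> * \<kappa> = 1" "\<kappa> * (\<kappa> * r) = r"
  using cd_sq_cases[OF c_B] by auto

lemma H_B: "x \<in> H \<Longrightarrow> x \<in> B"
  by (auto simp: H_def)

lemma H_scale: "s \<in> {1,-1} \<Longrightarrow> x \<in> H \<Longrightarrow> s *\<^sub>R x \<in> H"
proof -
  assume "s \<in> {1,-1}" "x \<in> H"
  then obtain r h where "r \<in> {1,-1}" "h \<in> {cd_e 0, c, t, u}" "x = r *\<^sub>R h"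
    unfolding H_def by blast
  with \<open>s \<in> {1,-1}\<close> show ?thesis
    unfolding H_def by (intro CollectI exI[of _ "s * r"] exI[of _ h]) auto
qed

lemma H_gens: "cd_e 0 \<in> H" "c \<in> H" "t \<in> H" "u \<in> H"
proof -
  have "1 *\<^sub>R h \<in> H" if "h \<in> {cd_e 0, c, t, u}" for h
    unfolding H_def using that by blast
  then show "cd_e 0 \<in> H" "c \<in> H" "t \<in> H" "u \<in> H" by simp_all
qed

lemma H_minus: "- x \<in> H \<longleftrightarrow> x \<in> H"
  using H_scale[of "-1" x] H_scale[of "-1" "-x"] by auto

lemma H_mult:
  assumes "x \<in> H" "y \<in> H"
  shows "x \<odot> y \<in> H"
proof -
  obtain s h where x: "s \<in> {1,-1}" "h \<in> {cd_e 0, c, t, u}" "x = s *\<^sub>R h"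
    using assms(1) unfolding H_def by blast
  obtain r g where y: "r \<in> {1,-1}" "g \<in> {cd_e 0, c, t, u}" "y = r *\<^sub>R g"
    using assms(2) unfolding H_def by blast
  \<comment> \<open>The remaining product of generators; only the fact that it is a signed unity
    matters for closure.\<close>
  have uu: "u \<odot> u = cd_sq \<gamma> (Suc m) u *\<^sub>R cd_e 0" by simp
  have "h \<odot> g \<in> H"
    using x(2) y(2)
    by (elim insertE; simp only: table tc uu cd_mult_e0 cd_e_carrier cd_pm_E_carrier c_B cd_te0_pm_E
      cd_mult_carrier zero_less_power zero_less_numeral H_minus H_gens empty_iff)
      (use \<kappa>(1) \<gamma>[of m] cd_sq_cases[of u n] in \<open>simp_all add: H_scale H_gens H_minus del: insert_iff\<close>)
  then have "(s * r) *\<^sub>R (h \<odot> g) \<in> H"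
    using x(1) y(1) by (intro H_scale) auto
  then show ?thesis by (simp add: x(3) y(3) mult.commute)
qed

text \<open>Multiplying by \<open>h\<close> a second time returns \<open>x\<close> up to sign, so
  closure of \<open>H\<close> under products can be read in both directions.\<close>

lemma H_cancel:
  assumes "x \<in> B" "h \<in> H"
  shows "x \<odot> h \<in> H \<longleftrightarrow> x \<in> H" "h \<odot> x \<in> H \<longleftrightarrow> x \<in> H"
proof -
  have *: "s *\<^sub>R x \<in> H \<Longrightarrow> s \<in> {1,-1} \<Longrightarrow> x \<in> H" for s
    by (auto simp: H_minus)
  have h: "h \<in> B" by (rule H_B) fact
  show "x \<odot> h \<in> H \<longleftrightarrow> x \<in> H"
    using H_mult[of "x \<odot> h" h] H_mult[of x h] *[of "cd_sq \<gamma> n h"] assms h cd_sq_cases[OF h] by auto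
  show "h \<odot> x \<in> H \<longleftrightarrow> x \<in> H"
    using H_mult[of h "h \<odot> x"] H_mult[of h x] *[of "cd_sq \<gamma> n h"] assms h cd_sq_cases[OF h] by auto
qed

section \<open>The orthogonality equations for basis elements outside \<open>H\<close>\<close>

lemma notin_H:
  assumes "a \<in> B" "a \<notin> H"
  shows "a \<notin> {cd_e 0, - cd_e 0, c, - c, t, - t, u, - u}"
  using assms(2) H_gens H_minus by auto

lemma H_cases:
  assumes "x \<in> H"
  obtains s h where "s \<in> {1,-1::real}" "h \<in> {cd_e 0, c, t, u}" "x = s *\<^sub>R h"
  using assms unfolding H_def by blast

lemma outside:
  assumes a: "a \<in> B" "a \<notin> H"
  shows "cd_conj n a = - a" "a \<odot> c = - (c \<odot> a)" "a \<odot> t = - (t \<odot> a)"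
    "(c \<odot> a) \<odot> t = (a \<odot> t) \<odot> c"
proof -
  note a' = notin_H[OF a]
  show "cd_conj n a = - a"
    using a a' by (simp add: cd_pm_E_conj_imag)
  show "a \<odot> c = - (c \<odot> a)" "a \<odot> t = - (t \<odot> a)"
    by (rule cd_pm_E_anticomm; use a a' c_neq t_neq u_neq in simp)+
  show "(c \<odot> a) \<odot> t = (a \<odot> t) \<odot> c"
    by (rule cd_mult_te0_swap; use a a' c_neq t_neq u_neq in simp)
qed

text \<open>The two products have four components. Since \<open>c\<close>, \<open>t\<close> and
  \<open>a\<close> are imaginary, the second components agree up to sign, which leaves three
  equations. The conjugate of \<open>b\<close> stays because \<open>b\<close> may be the unity up to
  sign.\<close>

lemma orth_v1_iff:
  assumes "a \<in> B" "cd_conj n a = - a" "b \<in> B"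
  shows "cd_orth \<gamma> (Suc n) v1 (cd_pair n a b) \<longleftrightarrow>
    b \<odot> c = t \<odot> a \<and> c \<odot> a = - (\<gamma> n *\<^sub>R (cd_conj n b \<odot> t)) \<and> a \<odot> c = \<gamma> n *\<^sub>R (t \<odot> b)"
  using assms by (auto simp: cd_orth_def cd_pair_eq_0_iff add_eq_0_iff2)

lemma orth_v2_iff:
  assumes "a \<in> B" "cd_conj n a = - a" "b \<in> B"
  shows "cd_orth \<gamma> (Suc n) v2 (cd_pair n a b) \<longleftrightarrow>
    a \<odot> t = c \<odot> b \<and> t \<odot> a = - (cd_conj n b \<odot> c) \<and> b \<odot> t = \<gamma> n *\<^sub>R (c \<odot> a)"
  using assms by (auto simp: cd_orth_def cd_pair_eq_0_iff add_eq_0_iff2)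


text \<open>Each equation is solved for \<open>b\<close>: its other side is rewritten as a product
  with right factor \<open>c\<close> or \<open>t\<close>, and that factor is cancelled.\<close>

lemma outside_iff:
  assumes a: "a \<in> B" "a \<notin> H" and b: "b \<in> B"
  shows "b \<odot> c = t \<odot> a \<longleftrightarrow> b = - (\<kappa> *\<^sub>R ((c \<odot> a) \<odot> t))"
    "c \<odot> a = \<gamma> n *\<^sub>R (b \<odot> t) \<longleftrightarrow> b = (\<gamma> n * \<gamma> m) *\<^sub>R ((c \<odot> a) \<odot> t)"
proof -
  have "b \<odot> c = t \<odot> a \<longleftrightarrow> b \<odot> c = (\<kappa> *\<^sub>R ((t \<odot> a) \<odot> c)) \<odot> c"
    using a \<kappa> by simp
  also have "\<dots> \<longleftrightarrow> b = \<kappa> *\<^sub>R ((t \<odot> a) \<odot> c)"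
    by (rule cd_cancel) (use a b in simp_all)
  \<comment> \<open>\<open>(t a) c = - (a t) c\<close>, and the swap identity turns
    \<open>(a t) c\<close> into \<open>(c a) t\<close>; thus both solutions are multiples of the
    same basis element.\<close>
  also have "(t \<odot> a) \<odot> c = - ((c \<odot> a) \<odot> t)"
    using outside[OF a] by simp
  finally show "b \<odot> c = t \<odot> a \<longleftrightarrow> b = - (\<kappa> *\<^sub>R ((c \<odot> a) \<odot> t))"
    by simp
  have "c \<odot> a = \<gamma> n *\<^sub>R (b \<odot> t) \<longleftrightarrow> (\<gamma> n *\<^sub>R b) \<odot> t = (\<gamma> m *\<^sub>R ((c \<odot> a) \<odot> t)) \<odot> t"
    using a by (auto simp: cd_sq_te0)
  also have "\<dots> \<longleftrightarrow> \<gamma> n *\<^sub>R b = \<gamma> m *\<^sub>R ((c \<odot> a) \<odot> t)"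
    by (rule cd_cancel) (use a b in simp_all)
  also have "\<dots> \<longleftrightarrow> \<gamma> n *\<^sub>R (\<gamma> n *\<^sub>R b) = \<gamma> n *\<^sub>R (\<gamma> m *\<^sub>R ((c \<odot> a) \<odot> t))"
    by (subst scaleR_cancel_left) simp
  finally show "c \<odot> a = \<gamma> n *\<^sub>R (b \<odot> t) \<longleftrightarrow> b = (\<gamma> n * \<gamma> m) *\<^sub>R ((c \<odot> a) \<odot> t)"
    by simp
qed

text \<open>When \<open>b\<close> is outside \<open>H\<close> as well, anticommutation with
  \<open>c\<close> and \<open>t\<close> reduces both systems of three equations to the same
  two.\<close>

lemma orth_outside:
  assumes a: "a \<in> B" "a \<notin> H" and b: "b \<in> B"
  shows "cd_orth \<gamma> (Suc n) v1 (cd_pair n a b) \<longleftrightarrow>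
      b \<odot> c = t \<odot> a \<and> c \<odot> a = \<gamma> n *\<^sub>R (b \<odot> t)" (is "?o1 \<longleftrightarrow> ?P")
    "cd_orth \<gamma> (Suc n) v2 (cd_pair n a b) \<longleftrightarrow>
      b \<odot> c = t \<odot> a \<and> c \<odot> a = \<gamma> n *\<^sub>R (b \<odot> t)" (is "?o2 \<longleftrightarrow> ?P")
proof -
  note oa = outside[OF a]
  have *: "(?o1 \<longleftrightarrow> ?P) \<and> (?o2 \<longleftrightarrow> ?P)" if "b \<notin> H"
  proof -
    note ob = outside[OF b that]
    have "b \<odot> t = \<gamma> n *\<^sub>R (c \<odot> a) \<longleftrightarrow> c \<odot> a = \<gamma> n *\<^sub>R (b \<odot> t)"
      by auto
    moreover have "t \<odot> b = - (b \<odot> t)" "c \<odot> b = - (b \<odot> c)"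
      using ob by simp_all
    ultimately show ?thesis
      unfolding orth_v1_iff[OF a(1) oa(1) b] orth_v2_iff[OF a(1) oa(1) b] ob(1) oa(2,3)
      by simp metis
  qed
  \<comment> \<open>Either system contains an equation that puts \<open>b\<close> outside
    \<open>H\<close>: for \<open>b\<close> in \<open>H\<close> it would place a product of
    \<open>a\<close> and \<open>t\<close> in \<open>H\<close>, hence \<open>a\<close>
    itself.\<close>
  have Hb: "b \<notin> H" if "b \<odot> c = t \<odot> a \<or> a \<odot> t = c \<odot> b"
    using that H_cancel[OF a(1) H_gens(3)] H_cancel[OF b H_gens(2)] a(2) by auto
  then show "?o1 \<longleftrightarrow> ?P" "?o2 \<longleftrightarrow> ?P"
    using * orth_v1_iff[OF a(1) oa(1) b] orth_v2_iff[OF a(1) oa(1) b] by auto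
qed

text \<open>The two solutions for \<open>b\<close> from \<open>outside_iff\<close> have to agree.
  The product \<open>\<gamma> n * \<gamma> m * \<kappa>\<close> is the value of
  \<open>\<chi>\<close>, by the lemma \<open>chi\<close>.\<close>

lemma orth_outside_chi:
  assumes a: "a \<in> B" "a \<notin> H" and b: "b \<in> B" and v: "v \<in> {v1, v2}"
    and orth: "cd_orth \<gamma> (Suc n) v (cd_pair n a b)"
  shows "\<gamma> n * \<gamma> m * \<kappa> = - 1"
proof -
  have "b \<odot> c = t \<odot> a" "c \<odot> a = \<gamma> n *\<^sub>R (b \<odot> t)"
    using orth v orth_outside[OF a b] by auto
  then have "- \<kappa> *\<^sub>R ((c \<odot> a) \<odot> t) = (\<gamma> n * \<gamma> m) *\<^sub>R ((c \<odot> a) \<odot> t)"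
    using outside_iff[OF a b] by (metis scaleR_minus_left)
  moreover have "(c \<odot> a) \<odot> t \<noteq> 0"
    using a by (intro cd_pm_E_nonzero[of _ n]) simp
  ultimately have "- \<kappa> = \<gamma> n * \<gamma> m"
    by (simp only: scaleR_cancel_right) simp
  then show ?thesis using \<kappa>(1) by auto
qed

text \<open>For this sign both solutions in \<open>outside_iff\<close> coincide, so
  \<open>b c = t a\<close> alone expresses orthogonality. It is transformed into the product
  condition by cancelling \<open>b\<close> and then multiplying by \<open>t\<close>.\<close>

lemma orth_outside_iff_mult:
  assumes a: "a \<in> B" "a \<notin> H" and b: "b \<in> B" and v: "v \<in> {v1, v2}"
    and chi: "\<gamma> n * \<gamma> m * \<kappa> = - 1"
  shows "cd_orth \<gamma> (Suc n) v (cd_pair n a b) \<longleftrightarrow> a \<odot> b = (\<gamma> m * cd_norm \<gamma> n b) *\<^sub>R u"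
proof -
  have k: "\<gamma> n * \<gamma> m = - \<kappa>"
    using chi \<kappa>(1) by auto
  have "cd_orth \<gamma> (Suc n) v (cd_pair n a b) \<longleftrightarrow> b \<odot> c = t \<odot> a"
    using v orth_outside[OF a b] outside_iff[OF a b] k by (auto simp: scaleR_minus_left)
  moreover have "b \<odot> c = t \<odot> a \<longleftrightarrow> a \<odot> b = (\<gamma> m * cd_norm \<gamma> n b) *\<^sub>R u" if "b \<notin> H"
  proof -
    note ob = outside[OF b that]
    have "cd_norm \<gamma> n b = - cd_sq \<gamma> n b"
      using notin_H[OF b that] b by (intro cd_norm_imag) auto
    then have "a \<odot> b = (\<gamma> m * cd_norm \<gamma> n b) *\<^sub>R u \<longleftrightarrow> a \<odot> b = (- \<gamma> m *\<^sub>R (u \<odot> b)) \<odot> b"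
      using b by simp
    also have "\<dots> \<longleftrightarrow> a = - \<gamma> m *\<^sub>R (u \<odot> b)"
      by (rule cd_cancel) (use a b in simp_all)
    \<comment> \<open>The swap identity is applied with \<open>b\<close> in the role of
      \<open>c\<close> and \<open>c\<close> in the role of \<open>a\<close>.\<close>
    also have "u \<odot> b = (b \<odot> c) \<odot> t"
    proof -
      have "c \<noteq> b \<odot> t" "c \<noteq> - (b \<odot> t)"
        using H_cancel[OF b H_gens(3)] H_gens(2) H_minus[of "b \<odot> t"] that by auto
      moreover have "c \<noteq> b" "c \<noteq> - b"
        using notin_H[OF b that] by auto
      ultimately show ?thesis
        by (intro cd_mult_te0_swap[symmetric]) (use notin_H[OF b that] b c_neq in simp_all)
    qed
    also have "a = - \<gamma> m *\<^sub>R ((b \<odot> c) \<odot> t) \<longleftrightarrow> a \<odot> t = (- \<gamma> m *\<^sub>R ((b \<odot> c) \<odot> t)) \<odot> t"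
      by (rule cd_cancel(2)[symmetric]) (use a b in simp_all)
    also have "\<dots> \<longleftrightarrow> - (t \<odot> a) = - (b \<odot> c)"
      using outside(3)[OF a] b by (simp add: cd_sq_te0)
    finally show ?thesis by auto
  qed
  \<comment> \<open>For \<open>b\<close> in \<open>H\<close> either equation would force
    \<open>a\<close> into \<open>H\<close>, so the case \<open>b\<close> outside \<open>H\<close>
    suffices.\<close>
  moreover have "b \<notin> H" if "b \<odot> c = t \<odot> a \<or> a \<odot> b = (\<gamma> m * cd_norm \<gamma> n b) *\<^sub>R u"
  proof
    assume bH: "b \<in> H"
    from that show False
    proof
      assume "b \<odot> c = t \<odot> a"
      then show False
        using H_cancel[OF a(1) H_gens(3)] H_mult[OF bH H_gens(2)] a(2) by auto
    next
      assume *: "a \<odot> b = (\<gamma> m * cd_norm \<gamma> n b) *\<^sub>R u"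
      have "\<gamma> m * cd_norm \<gamma> n b \<in> {1,-1}"
        using cd_norm_cases[OF b] \<gamma>[of m] by auto
      from H_scale[OF this H_gens(4)] show False
        using H_cancel[OF a(1) bH] a(2) * by auto
    qed
  qed
  ultimately show ?thesis by blast
qed

end

section \<open>The zero divisor graph\<close>

lemma span_singleton_eqE:
  fixes x v :: "'a::real_vector"
  assumes "span {x} = span {v}" "x \<noteq> 0"
  obtains r where "r \<noteq> 0" "x = r *\<^sub>R v"
proof -
  have "x \<in> span {v}"
    using assms(1) span_base[of x "{x}"] by simp
  then obtain r where "x = r *\<^sub>R v" by (auto simp: span_singleton)
  with assms(2) show thesis by (intro that[of r]) auto
qed

lemma span_singleton_scale: "r \<noteq> 0 \<Longrightarrow> span {r *\<^sub>R v} = span {v :: 'a::real_vector}"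
  using span_image_scale[of "{v}" "\<lambda>_. r"] by simp

lemma cd_orth_scale:
  "r \<noteq> 0 \<Longrightarrow> cd_orth \<gamma> k (r *\<^sub>R x) y \<longleftrightarrow> cd_orth \<gamma> k x y"
  "r \<noteq> 0 \<Longrightarrow> cd_orth \<gamma> k x (r *\<^sub>R y) \<longleftrightarrow> cd_orth \<gamma> k x y"
  by (auto simp: cd_orth_def)

lemma cd_orth_sym: "cd_orth \<gamma> k x y \<longleftrightarrow> cd_orth \<gamma> k y x"
  by (auto simp: cd_orth_def)

lemma cd_orth_zero_divisor:
  assumes "cd_orth \<gamma> k x y" "x \<in> cd_carrier k" "y \<in> cd_carrier k" "x \<noteq> 0" "y \<noteq> 0"
  shows "cd_zero_divisor \<gamma> k x"
  using assms by (auto simp: cd_orth_def cd_zero_divisor_def)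

lemma cd_zero_divisor_scale:
  assumes "r \<noteq> 0" "cd_zero_divisor \<gamma> k x"
  shows "cd_zero_divisor \<gamma> k (r *\<^sub>R x)"
  using assms by (auto simp: cd_zero_divisor_def)

lemma cd_E'_pm_E: "x \<in> cd_E' k \<Longrightarrow> x \<in> cd_pm (cd_E k)"
  by (auto simp: cd_E'_def cd_pm_def)

lemma cd_E'_neq: "x \<in> cd_E' k \<Longrightarrow> x \<notin> {cd_e 0, - cd_e 0}"
  by (auto simp: cd_E'_def cd_E_def)

lemma cd_Ze'_iff:
  "z \<in> cd_Ze' \<gamma> k \<longleftrightarrow> (\<exists>x\<in>cd_E' k. \<exists>y\<in>cd_pm (cd_E k). z = cd_pair k x y) \<and> cd_zero_divisor \<gamma> (Suc k) z"
  unfolding cd_Ze'_def by blast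

lemma cd_pair_Ze'_iff:
  assumes "a \<in> cd_carrier k" "b \<in> cd_carrier k"
  shows "cd_pair k a b \<in> cd_Ze' \<gamma> k \<longleftrightarrow>
    a \<in> cd_E' k \<and> b \<in> cd_pm (cd_E k) \<and> cd_zero_divisor \<gamma> (Suc k) (cd_pair k a b)"
  unfolding cd_Ze'_iff using assms cd_pair_eq_iff[of a k b] cd_E'_pm_E cd_pm_E_carrier by metis

lemma cd_Ze'_nonzero: "z \<in> cd_Ze' \<gamma> k \<Longrightarrow> z \<noteq> 0 \<and> z \<in> cd_carrier (Suc k)"
  by (auto simp: cd_Ze'_def cd_zero_divisor_def)

text \<open>Elements of \<open>cd_Ze'\<close> have an unsigned first half, so the sign of
  \<open>x\<close> is moved in front of the whole pair.\<close>

lemma cd_pair_normal: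
  assumes "x \<in> cd_pm (cd_E k)" "x \<notin> {cd_e 0, - cd_e 0}" "y \<in> cd_pm (cd_E k)"
  obtains s x' y' where "s \<in> {1,-1::real}" "x' \<in> cd_E' k" "y' \<in> cd_pm (cd_E k)"
    "cd_pair k x y = s *\<^sub>R cd_pair k x' y'"
proof -
  obtain s j where x: "s \<in> {1,-1::real}" "j < 2 ^ k" "x = s *\<^sub>R cd_e j"
    using assms(1) by (rule cd_pm_EE)
  have "cd_pair k x y = s *\<^sub>R cd_pair k (cd_e j) (s *\<^sub>R y)"
    using x by (auto simp: cd_pair_scaleR)
  moreover have "cd_e j \<in> cd_E' k"
    using x assms(2) by (auto simp: cd_E'_def cd_E_def)
  ultimately show thesis using x(1) assms(3) by (intro that[of s "cd_e j" "s *\<^sub>R y"]) auto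
qed

text \<open>Both ends are automatically zero divisors, since each annihilates the other and neither
  is zero. Another representative of the line of \<open>v\<close> differs from \<open>v\<close> by a
  nonzero factor, which does not affect orthogonality.\<close>

lemma cd_edge_iff:
  assumes v: "x \<in> cd_pm (cd_E k)" "x \<notin> {cd_e 0, - cd_e 0}" "y \<in> cd_pm (cd_E k)" "v = cd_pair k x y"
  shows "{span {v}, L} \<in> cd_edges \<gamma> k \<longleftrightarrow>
    (\<exists>a\<in>cd_E' k. \<exists>b\<in>cd_pm (cd_E k). L = span {cd_pair k a b} \<and> L \<noteq> span {v} \<and>
      cd_orth \<gamma> (Suc k) v (cd_pair k a b))" (is "?l \<longleftrightarrow> ?r")
proof
  assume ?l
  then obtain z w where zw: "z \<in> cd_Ze' \<gamma> k" "w \<in> cd_Ze' \<gamma> k" "span {z} \<noteq> span {w}"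
    "cd_orth \<gamma> (Suc k) z w" "{span {v}, L} = {span {z}, span {w}}"
    unfolding cd_edges_def by blast
  have *: ?r if prems: "z \<in> cd_Ze' \<gamma> k" "w \<in> cd_Ze' \<gamma> k" "span {z} \<noteq> span {w}"
    "cd_orth \<gamma> (Suc k) z w" "span {z} = span {v}" "L = span {w}" for z w
  proof -
    obtain r where "r \<noteq> 0" "z = r *\<^sub>R v"
      using span_singleton_eqE[OF prems(5)] cd_Ze'_nonzero[OF prems(1)] by metis
    then have "cd_orth \<gamma> (Suc k) v w" using prems(4) by (simp add: cd_orth_scale)
    moreover obtain a b where "a \<in> cd_E' k" "b \<in> cd_pm (cd_E k)" "w = cd_pair k a b"
      using prems(2) unfolding cd_Ze'_iff by blast
    moreover have "L \<noteq> span {v}"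
      using prems(3,5,6) by simp
    ultimately show ?r using prems(6) by blast
  qed
  from zw(5) consider "span {z} = span {v}" "L = span {w}" | "span {w} = span {v}" "L = span {z}"
    unfolding doubleton_eq_iff by blast
  then show ?r
  proof cases
    case 1
    show ?thesis by (rule *[OF zw(1-4) 1])
  next
    case 2
    show ?thesis by (rule *[OF zw(2,1) zw(3)[symmetric] cd_orth_sym[THEN iffD1, OF zw(4)] 2])
  qed
next
  assume ?r
  then obtain a b where ab: "a \<in> cd_E' k" "b \<in> cd_pm (cd_E k)" "L = span {cd_pair k a b}"
    "L \<noteq> span {v}" "cd_orth \<gamma> (Suc k) v (cd_pair k a b)" by blast
  have aB: "a \<in> cd_pm (cd_E k)" by (rule cd_E'_pm_E) fact
  have v0: "v \<noteq> 0" "cd_pair k a b \<noteq> 0"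
    using v aB cd_pm_E_nonzero[OF v(1)] cd_pm_E_nonzero[OF aB] ab(2) by (auto simp: cd_pair_eq_0_iff)
  obtain s x' y' where w: "s \<in> {1,-1::real}" "x' \<in> cd_E' k" "y' \<in> cd_pm (cd_E k)"
    "v = s *\<^sub>R cd_pair k x' y'"
    unfolding v(4) by (rule cd_pair_normal[OF v(1-3)])
  have s: "s \<noteq> 0" "s *\<^sub>R v = cd_pair k x' y'" using w(1,4) by auto
  have zd: "cd_zero_divisor \<gamma> (Suc k) v" "cd_zero_divisor \<gamma> (Suc k) (cd_pair k a b)"
    using cd_orth_zero_divisor[OF ab(5)] cd_orth_zero_divisor[OF cd_orth_sym[THEN iffD1, OF ab(5)]]
      v0 v(4) by simp_all
  have "cd_pair k a b \<in> cd_Ze' \<gamma> k" using ab zd unfolding cd_Ze'_iff by blast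
  moreover have "s *\<^sub>R v \<in> cd_Ze' \<gamma> k"
    using w(2,3) s zd cd_zero_divisor_scale[OF s(1) zd(1)] unfolding cd_Ze'_iff by blast
  moreover have "span {s *\<^sub>R v} = span {v}" by (rule span_singleton_scale) fact
  moreover have "cd_orth \<gamma> (Suc k) (s *\<^sub>R v) (cd_pair k a b)"
    using ab(5) s(1) by (simp add: cd_orth_scale)
  moreover have "span {s *\<^sub>R v} \<noteq> span {cd_pair k a b}"
    using ab(3,4) calculation(3) by simp
  moreover have "{span {v}, L} = {span {s *\<^sub>R v}, span {cd_pair k a b}}"
    using ab(3) calculation(3) by simp
  ultimately show ?l
    unfolding cd_edges_def by blast
qed

lemma cd_edgesE:
  assumes "E \<in> cd_edges \<gamma> k" "p \<in> E"
  obtains q where "E = {p, q}"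
  using assms unfolding cd_edges_def by blast

lemma cd_pm_Ze'_iff:
  assumes v: "x \<in> cd_pm (cd_E k)" "x \<notin> {cd_e 0, - cd_e 0}" "y \<in> cd_pm (cd_E k)" "v = cd_pair k x y"
  shows "v \<in> cd_pm (cd_Ze' \<gamma> k) \<longleftrightarrow> cd_zero_divisor \<gamma> (Suc k) v"
    "span {v} \<in> cd_vertices \<gamma> k \<longleftrightarrow> cd_zero_divisor \<gamma> (Suc k) v"
proof -
  obtain s x' y' where w: "s \<in> {1,-1::real}" "x' \<in> cd_E' k" "y' \<in> cd_pm (cd_E k)"
    "v = s *\<^sub>R cd_pair k x' y'"
    unfolding v(4) by (rule cd_pair_normal[OF v(1-3)])
  have s: "s \<noteq> 0" "s *\<^sub>R v = cd_pair k x' y'" using w(1,4) by auto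
  have v0: "v \<noteq> 0" using v cd_pm_E_nonzero[OF v(1)] by (simp add: cd_pair_eq_0_iff)
  have zd: "cd_zero_divisor \<gamma> (Suc k) v \<Longrightarrow> s *\<^sub>R v \<in> cd_Ze' \<gamma> k"
    using w(2,3) s cd_zero_divisor_scale[OF s(1)] unfolding cd_Ze'_iff by blast
  have m: "cd_zero_divisor \<gamma> (Suc k) (- z) \<Longrightarrow> cd_zero_divisor \<gamma> (Suc k) z" for z
    using cd_zero_divisor_scale[of "-1" \<gamma> "Suc k" "-z"] by simp
  show "v \<in> cd_pm (cd_Ze' \<gamma> k) \<longleftrightarrow> cd_zero_divisor \<gamma> (Suc k) v"
  proof
    assume "v \<in> cd_pm (cd_Ze' \<gamma> k)"
    then show "cd_zero_divisor \<gamma> (Suc k) v"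
      using m[of v] by (auto simp: cd_pm_def cd_Ze'_iff intro: m)
  next
    assume "cd_zero_divisor \<gamma> (Suc k) v"
    from zd[OF this] show "v \<in> cd_pm (cd_Ze' \<gamma> k)"
      using w(1) by (force simp: cd_pm_def image_iff)
  qed
  show "span {v} \<in> cd_vertices \<gamma> k \<longleftrightarrow> cd_zero_divisor \<gamma> (Suc k) v"
  proof
    assume "span {v} \<in> cd_vertices \<gamma> k"
    then obtain z where z: "z \<in> cd_Ze' \<gamma> k" "span {v} = span {z}"
      unfolding cd_vertices_def by blast
    then obtain r where "r \<noteq> 0" "v = r *\<^sub>R z"
      using span_singleton_eqE v0 by metis
    then show "cd_zero_divisor \<gamma> (Suc k) v"
      using z(1) by (simp add: cd_Ze'_iff cd_zero_divisor_scale)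
  next
    assume "cd_zero_divisor \<gamma> (Suc k) v"
    from zd[OF this] show "span {v} \<in> cd_vertices \<gamma> k"
      using span_singleton_scale[OF s(1), of v] unfolding cd_vertices_def by blast
  qed
qed

section \<open>Associativity of the second algebra\<close>

lemma cd_assoc_Suc:
  assumes comm: "\<And>x y. x \<in> cd_carrier k \<Longrightarrow> y \<in> cd_carrier k \<Longrightarrow> cd_mult \<gamma> k x y = cd_mult \<gamma> k y x"
    and assoc: "\<And>x y z. x \<in> cd_carrier k \<Longrightarrow> y \<in> cd_carrier k \<Longrightarrow> z \<in> cd_carrier k \<Longrightarrow>
      cd_mult \<gamma> k (cd_mult \<gamma> k x y) z = cd_mult \<gamma> k x (cd_mult \<gamma> k y z)"
    and xyz: "x \<in> cd_carrier (Suc k)" "y \<in> cd_carrier (Suc k)" "z \<in> cd_carrier (Suc k)"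
  shows "cd_mult \<gamma> (Suc k) (cd_mult \<gamma> (Suc k) x y) z = cd_mult \<gamma> (Suc k) x (cd_mult \<gamma> (Suc k) y z)"
proof -
  \<comment> \<open>Left commutativity completes \<open>assoc\<close> and \<open>comm\<close> to a
    rewriting system that brings the products in each component into a normal order.\<close>
  have lcomm: "cd_mult \<gamma> k x (cd_mult \<gamma> k y z) = cd_mult \<gamma> k y (cd_mult \<gamma> k x z)"
    if "x \<in> cd_carrier k" "y \<in> cd_carrier k" "z \<in> cd_carrier k" for x y z
    by (simp only: assoc[symmetric] that) (simp only: comm[of x y] that)
  from xyz obtain a b c d e f where x: "a \<in> cd_carrier k" "b \<in> cd_carrier k" "x = cd_pair k a b"
    and y: "c \<in> cd_carrier k" "d \<in> cd_carrier k" "y = cd_pair k c d"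
    and z: "e \<in> cd_carrier k" "f \<in> cd_carrier k" "z = cd_pair k e f"
    by (elim cd_carrier_SucE) blast
  note C = x(1,2) y(1,2) z(1,2)
  show ?thesis
    unfolding x(3) y(3) z(3) using C
    by (simp add: cd_mult_conj, intro arg_cong2[of _ _ _ _ "cd_pair k"])
      (simp_all only: assoc lcomm comm C cd_mult_carrier cd_conj_carrier scaleR_add_right add_ac)
qed

text \<open>The involution at level 0 is trivial, so level 1 is commutative as well as associative,
  and doubling a commutative associative algebra gives an associative one.\<close>

lemma cd_assoc:
  assumes "x \<in> cd_carrier 2" "y \<in> cd_carrier 2" "z \<in> cd_carrier 2"
  shows "cd_mult \<gamma> 2 (cd_mult \<gamma> 2 x y) z = cd_mult \<gamma> 2 x (cd_mult \<gamma> 2 y z)"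
proof -
  have comm0: "cd_mult \<gamma> 0 x y = cd_mult \<gamma> 0 y x" for x y
    by (simp add: mult.commute)
  have comm1: "cd_mult \<gamma> (Suc 0) x y = cd_mult \<gamma> (Suc 0) y x"
    if "x \<in> cd_carrier (Suc 0)" "y \<in> cd_carrier (Suc 0)" for x y
    using that by (elim cd_carrier_SucE) (simp add: mult.commute add.commute)
  have assoc1: "cd_mult \<gamma> (Suc 0) (cd_mult \<gamma> (Suc 0) x y) z = cd_mult \<gamma> (Suc 0) x (cd_mult \<gamma> (Suc 0) y z)"
    if "x \<in> cd_carrier (Suc 0)" "y \<in> cd_carrier (Suc 0)" "z \<in> cd_carrier (Suc 0)" for x y z
    by (rule cd_assoc_Suc[OF comm0 _ that]) (simp add: mult.assoc)
  show ?thesis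
    using cd_assoc_Suc[OF comm1 assoc1, of x y z] assms by (simp add: numeral_2_eq_2)
qed

section \<open>The case \<open>\<chi> = 1\<close>: orthogonality inside \<open>H\<close> and the
  path\<close>

context cd_doubled
begin

abbreviation v0 where "v0 \<equiv> cd_pair n u (- \<gamma> m *\<^sub>R cd_e 0)"
abbreviation v3 where "v3 \<equiv> cd_pair n u (\<gamma> m *\<^sub>R cd_e 0)"

text \<open>All norms involved are signs, so dividing by one is multiplying by it, and exchanging
  numerator and denominator changes nothing.\<close>

lemma chi: "cd_chi \<gamma> n v1 = \<gamma> n * \<gamma> m * \<kappa>" "cd_chi \<gamma> n v2 = \<gamma> n * \<gamma> m * \<kappa>"
proof -
  have N: "cd_norm \<gamma> n c = - \<kappa>" "cd_norm \<gamma> n t = - \<gamma> m" "cd_norm \<gamma> n (\<gamma> n *\<^sub>R c) = - \<kappa>"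
    using cd_norm_imag[OF c_B] cd_norm_imag[of t n] c_neq t_neq
    by (auto simp: cd_sq_te0 cd_norm_def)
  show "cd_chi \<gamma> n v1 = \<gamma> n * \<gamma> m * \<kappa>"
    using \<gamma>[of m] by (auto simp: cd_chi_def N)
  show "cd_chi \<gamma> n v2 = \<gamma> n * \<gamma> m * \<kappa>"
    using \<kappa>(1) by (auto simp: cd_chi_def N)
qed

lemma \<gamma>_scale_B [simp]: "x \<in> B \<Longrightarrow> \<gamma> k *\<^sub>R x \<in> B" "x \<in> B \<Longrightarrow> - (\<gamma> k *\<^sub>R x) \<in> B"
  using \<gamma>[of k] by auto

lemma scaleR_basis_eq: "r *\<^sub>R x = s *\<^sub>R x \<longleftrightarrow> r = s" if "x \<in> B" for r s :: real and x
  using cd_pm_E_nonzero[OF that] by simp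

lemma chi_eq_1_iff: "\<gamma> m = \<gamma> n * \<kappa> \<longleftrightarrow> \<gamma> n * \<gamma> m * \<kappa> = 1" "\<kappa> = \<gamma> n * \<gamma> m \<longleftrightarrow> \<gamma> n * \<gamma> m * \<kappa> = 1"
  "\<gamma> m * \<kappa> = \<gamma> n \<longleftrightarrow> \<gamma> n * \<gamma> m * \<kappa> = 1"
  using \<gamma>[of m] \<gamma>[of n] \<kappa>(1) by auto

lemma \<gamma>\<kappa>_cases: "\<gamma> m * \<kappa> \<in> {1,-1}"
  using \<gamma>[of m] \<kappa>(1) by auto

text \<open>Up to sign \<open>a\<close> is \<open>c\<close>, \<open>t\<close> or \<open>u\<close>.
  The equation \<open>b c = t a\<close> then leaves a single \<open>b\<close>, and the second
  equation reduces to \<open>\<chi> = 1\<close>. The resulting pairs are \<open>v1\<close>,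
  \<open>v2\<close> and \<open>v0\<close> up to sign; for \<open>a = t\<close>, recognising
  \<open>v2\<close> uses \<open>\<chi> = 1\<close>.\<close>

lemma orth_v1_H:
  assumes a: "a \<in> H" "a \<notin> {cd_e 0, - cd_e 0}" and b: "b \<in> B"
    and orth: "cd_orth \<gamma> (Suc n) v1 (cd_pair n a b)"
  shows "\<gamma> n * \<gamma> m * \<kappa> = 1 \<and> (\<exists>s\<in>{1,-1}. \<exists>v\<in>{v0, v1, v2}. cd_pair n a b = s *\<^sub>R v)"
proof -
  have aB: "a \<in> B" by (rule H_B) fact
  have eqs: "b \<odot> c = t \<odot> a" "c \<odot> a = - (\<gamma> n *\<^sub>R (cd_conj n b \<odot> t))"
    using orth orth_v1_iff[OF aB cd_pm_E_conj_imag[OF aB a(2)] b] by blast+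
  obtain s h where s: "s \<in> {1,-1::real}" "h \<in> {cd_e 0, c, t, u}" "a = s *\<^sub>R h"
    using a(1) by (rule H_cases)
  have ss: "s * s = 1" "s * (s * r) = r" "s \<noteq> 0" for r using s(1) by auto
  have b': "b = s *\<^sub>R w" if "w \<in> B" "t \<odot> h = w \<odot> c" for w
  proof -
    have "b \<odot> c = (s *\<^sub>R w) \<odot> c" using eqs(1) that by (simp add: s(3))
    then show ?thesis by (subst (asm) cd_cancel(2)) (use b that in auto)
  qed
  have eq2: "c \<odot> h = - (\<gamma> n *\<^sub>R (cd_conj n w \<odot> t))" if "b = s *\<^sub>R w" for w
  proof -
    have "s *\<^sub>R (c \<odot> h) = s *\<^sub>R (- (\<gamma> n *\<^sub>R (cd_conj n w \<odot> t)))"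
      using eqs(2) by (simp add: s(3) that mult.commute)
    then show ?thesis using ss by (simp only: scaleR_cancel_left) auto
  qed
  consider "h = c" | "h = t" | "h = u"
    using s a(2) by auto
  then show ?thesis
  proof cases
    case 1
    have "b = s *\<^sub>R t" by (rule b') (simp_all add: 1)
    with eq2[OF this] show ?thesis
      using s(1) by (force simp: 1 s(3) cd_sq_te0 scaleR_basis_eq chi_eq_1_iff cd_pair_scaleR)
  next
    case 2
    have "b = s *\<^sub>R ((\<gamma> m * \<kappa>) *\<^sub>R c)" by (rule b') (use \<gamma>\<kappa>_cases in \<open>simp_all add: 2 cd_sq_te0 \<kappa>\<close>)
    moreover have "u = (\<gamma> n * \<gamma> m * \<kappa>) *\<^sub>R u"
      using eq2[OF calculation] by (simp add: 2 mult.assoc)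
    then have "\<gamma> n * \<gamma> m * \<kappa> = 1"
      using scaleR_basis_eq[of u 1 "\<gamma> n * \<gamma> m * \<kappa>"] by simp
    moreover from this have "\<gamma> m * \<kappa> = \<gamma> n" by (simp add: chi_eq_1_iff)
    ultimately show ?thesis
      using s(1) by (force simp: 2 s(3) cd_pair_scaleR)
  next
    case 3
    have *: "b = s *\<^sub>R (- \<gamma> m *\<^sub>R cd_e 0)" by (rule b') (simp_all add: 3 table)
    have "\<kappa> *\<^sub>R t = (\<gamma> n * \<gamma> m) *\<^sub>R t"
      using eq2[OF *] by (simp add: 3)
    then have "\<gamma> n * \<gamma> m * \<kappa> = 1" by (simp add: scaleR_basis_eq chi_eq_1_iff del: scaleR_cancel_right)
    then show ?thesis
      using s(1) * by (force simp: 3 s(3) cd_pair_scaleR)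
  qed
qed

text \<open>As for \<open>v1\<close>, with \<open>a t = c b\<close> determining \<open>b\<close>.
  The case of \<open>u\<close> now gives \<open>b\<close> the opposite sign, hence \<open>v3\<close>
  in place of \<open>v0\<close>.\<close>

lemma orth_v2_H:
  assumes a: "a \<in> H" "a \<notin> {cd_e 0, - cd_e 0}" and b: "b \<in> B"
    and orth: "cd_orth \<gamma> (Suc n) v2 (cd_pair n a b)"
  shows "\<gamma> n * \<gamma> m * \<kappa> = 1 \<and> (\<exists>s\<in>{1,-1}. \<exists>v\<in>{v1, v2, v3}. cd_pair n a b = s *\<^sub>R v)"
proof -
  have aB: "a \<in> B" by (rule H_B) fact
  have eqs: "a \<odot> t = c \<odot> b" "b \<odot> t = \<gamma> n *\<^sub>R (c \<odot> a)"
    using orth orth_v2_iff[OF aB cd_pm_E_conj_imag[OF aB a(2)] b] by blast+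
  obtain s h where s: "s \<in> {1,-1::real}" "h \<in> {cd_e 0, c, t, u}" "a = s *\<^sub>R h"
    using a(1) by (rule H_cases)
  have ss: "s * s = 1" "s * (s * r) = r" "s \<noteq> 0" for r using s(1) by auto
  have b': "b = s *\<^sub>R w" if "w \<in> B" "h \<odot> t = c \<odot> w" for w
  proof -
    have "c \<odot> b = c \<odot> (s *\<^sub>R w)" using eqs(1) that by (simp add: s(3))
    then show ?thesis by (subst (asm) cd_cancel(1)) (use b that in auto)
  qed
  have eq2: "w \<odot> t = \<gamma> n *\<^sub>R (c \<odot> h)" if "b = s *\<^sub>R w" for w
  proof -
    have "s *\<^sub>R (w \<odot> t) = s *\<^sub>R (\<gamma> n *\<^sub>R (c \<odot> h))"
      using eqs(2) by (simp add: s(3) that mult.commute)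
    then show ?thesis using ss by (simp only: scaleR_cancel_left) auto
  qed
  consider "h = c" | "h = t" | "h = u"
    using s a(2) by auto
  then show ?thesis
  proof cases
    case 1
    have "b = s *\<^sub>R t" by (rule b') (simp_all add: 1)
    with eq2[OF this] show ?thesis
      using s(1) by (force simp: 1 s(3) cd_sq_te0 scaleR_basis_eq chi_eq_1_iff cd_pair_scaleR)
  next
    case 2
    have "b = s *\<^sub>R ((\<gamma> m * \<kappa>) *\<^sub>R c)" by (rule b') (use \<gamma>\<kappa>_cases in \<open>simp_all add: 2 cd_sq_te0 \<kappa>\<close>)
    moreover have "(\<gamma> m * \<kappa>) *\<^sub>R u = \<gamma> n *\<^sub>R u"
      using eq2[OF calculation] by (simp add: 2)
    then have "\<gamma> m * \<kappa> = \<gamma> n"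
      using scaleR_basis_eq[of u "\<gamma> m * \<kappa>" "\<gamma> n"] by simp
    moreover from this have "\<gamma> n * \<gamma> m * \<kappa> = 1" by (simp add: chi_eq_1_iff)
    ultimately show ?thesis
      using s(1) by (force simp: 2 s(3) cd_pair_scaleR)
  next
    case 3
    have *: "b = s *\<^sub>R (\<gamma> m *\<^sub>R cd_e 0)" by (rule b') (simp_all add: 3 table)
    have "\<gamma> m *\<^sub>R t = (\<gamma> n * \<kappa>) *\<^sub>R t"
      using eq2[OF *] by (simp add: 3)
    then have "\<gamma> n * \<gamma> m * \<kappa> = 1" by (simp add: scaleR_basis_eq chi_eq_1_iff del: scaleR_cancel_right)
    then show ?thesis
      using s(1) * by (force simp: 3 s(3) cd_pair_scaleR)
  qed
qed

lemma orth_path: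
  assumes "\<gamma> n * \<gamma> m * \<kappa> = 1"
  shows "cd_orth \<gamma> (Suc n) v1 v0" "cd_orth \<gamma> (Suc n) v1 v1" "cd_orth \<gamma> (Suc n) v1 v2"
    "cd_orth \<gamma> (Suc n) v2 v1" "cd_orth \<gamma> (Suc n) v2 v2" "cd_orth \<gamma> (Suc n) v2 v3"
proof -
  have k: "\<kappa> = \<gamma> n * \<gamma> m" using assms by (simp add: chi_eq_1_iff)
  show "cd_orth \<gamma> (Suc n) v1 v0" "cd_orth \<gamma> (Suc n) v1 v1" "cd_orth \<gamma> (Suc n) v1 v2"
    by (subst orth_v1_iff; simp add: table tc cd_sq_te0 k mult_ac)+
  show "cd_orth \<gamma> (Suc n) v2 v1" "cd_orth \<gamma> (Suc n) v2 v2" "cd_orth \<gamma> (Suc n) v2 v3"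
    by (subst orth_v2_iff; simp add: table tc cd_sq_te0 k mult_ac)+
qed

lemma v_nonzero: "v0 \<noteq> 0" "v1 \<noteq> 0" "v2 \<noteq> 0" "v3 \<noteq> 0"
  using cd_pm_E_nonzero[of c n] cd_pm_E_nonzero[of t n] cd_pm_E_nonzero[of u n]
  by (simp_all add: cd_pair_eq_0_iff)

text \<open>The first halves \<open>u\<close>, \<open>c\<close>, \<open>t\<close> are pairwise
  non-proportional. Only \<open>v0\<close> and \<open>v3\<close> share a first half, and their
  second halves have opposite signs.\<close>

lemma span_distinct:
  "distinct [span {v0}, span {v1}, span {v2}, span {v3}]"
proof -
  have scale: False if prems: "x \<in> B" "y \<in> B" "x \<noteq> y" "x \<noteq> - y" "x = r *\<^sub>R y" for x y :: cd and r
  proof -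
    obtain p i where x: "p \<in> {1,-1::real}" "i < 2 ^ n" "x = p *\<^sub>R cd_e i"
      using prems(1) by (rule cd_pm_EE)
    obtain q j where y: "q \<in> {1,-1::real}" "j < 2 ^ n" "y = q *\<^sub>R cd_e j"
      using prems(2) by (rule cd_pm_EE)
    have "i \<noteq> j" using prems(3,4) x(1,3) y(1,3) by auto
    then show False
      using prems(5) x(1,3) y(1,3)
      by (auto simp: cd_e_def poly_mapping_eq_iff fun_eq_iff lookup_single lookup_minus when_def split: if_splits)
  qed
  have *: "span {cd_pair n x y} \<noteq> span {cd_pair n x' y'}"
    if prems: "x \<in> B" "x' \<in> B" "y \<in> B" "y' \<in> B" "x \<noteq> x'" "x \<noteq> - x'" for x x' y y'
  proof
    have "cd_pair n x y \<noteq> 0"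
      using prems cd_pm_E_nonzero[of x n] by (simp add: cd_pair_eq_0_iff)
    moreover assume "span {cd_pair n x y} = span {cd_pair n x' y'}"
    ultimately obtain r where "cd_pair n x y = r *\<^sub>R cd_pair n x' y'"
      by (metis span_singleton_eqE)
    then have "x = r *\<^sub>R x'" using prems by (simp add: cd_pair_scaleR cd_pair_eq_iff)
    with scale[of x x'] prems show False by blast
  qed
  have "span {v0} \<noteq> span {v3}"
  proof
    assume "span {v0} = span {v3}"
    then obtain r where r: "v0 = r *\<^sub>R v3"
      by (rule span_singleton_eqE) (rule v_nonzero)
    then have "1 *\<^sub>R u = r *\<^sub>R u" "(- \<gamma> m) *\<^sub>R cd_e 0 = (r * \<gamma> m) *\<^sub>R cd_e 0"
      by (simp_all add: cd_pair_scaleR cd_pair_eq_iff)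
    then have "r = 1" "- \<gamma> m = r * \<gamma> m"
      using cd_pm_E_nonzero[of u n] by (simp_all only: scaleR_cancel_right) auto
    then show False using \<gamma>[of m] by auto
  qed
  moreover have "u \<noteq> c" "u \<noteq> - c" "u \<noteq> t" "u \<noteq> - t" "c \<noteq> t" "c \<noteq> - t" "t \<noteq> u" "t \<noteq> - u" "c \<noteq> u" "c \<noteq> - u"
    using u_neq c_neq by (auto simp: equation_minus_iff)
  ultimately show ?thesis by (simp add: *)
qed

lemma v_form:
  assumes "v \<in> {v0, v1, v2, v3}"
  obtains x y where "x \<in> B" "x \<notin> {cd_e 0, - cd_e 0}" "y \<in> B" "v = cd_pair n x y"
  using assms u_neq c_neq t_neq that[of u "- \<gamma> m *\<^sub>R cd_e 0"] that[of c t] that[of t "\<gamma> n *\<^sub>R c"]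
    that[of u "\<gamma> m *\<^sub>R cd_e 0"] by auto

lemma edge_v_iff:
  assumes "v \<in> {v0, v1, v2, v3}"
  shows "{span {v}, L} \<in> cd_edges \<gamma> n \<longleftrightarrow>
    (\<exists>a\<in>cd_E' n. \<exists>b\<in>B. L = span {cd_pair n a b} \<and> L \<noteq> span {v} \<and>
      cd_orth \<gamma> (Suc n) v (cd_pair n a b))"
  using assms by (elim v_form) (rule cd_edge_iff)

text \<open>The first half of \<open>w\<close> may carry a sign; normalising it changes neither the
  line of \<open>w\<close> nor its orthogonality to \<open>v\<close>.\<close>

lemma edge_vI:
  assumes "v \<in> {v0, v1, v2, v3}" "w \<in> {v0, v1, v2, v3}" "span {w} \<noteq> span {v}" "cd_orth \<gamma> (Suc n) v w"
  shows "{span {v}, span {w}} \<in> cd_edges \<gamma> n"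
proof -
  from assms(2) obtain x y where xy: "x \<in> B" "x \<notin> {cd_e 0, - cd_e 0}" "y \<in> B" "w = cd_pair n x y"
    by (rule v_form)
  obtain s x' y' where w: "s \<in> {1,-1::real}" "x' \<in> cd_E' n" "y' \<in> B" "w = s *\<^sub>R cd_pair n x' y'"
    unfolding xy(4) by (rule cd_pair_normal[OF xy(1-3)])
  have s: "s \<noteq> 0" using w by auto
  have "span {w} = span {cd_pair n x' y'}"
    unfolding w(4) by (rule span_singleton_scale) fact
  moreover have "cd_orth \<gamma> (Suc n) v (cd_pair n x' y')"
    using assms(4) s by (simp add: w(4) cd_orth_scale)
  ultimately show ?thesis
    unfolding edge_v_iff[OF assms(1)] using w(2,3) assms(3) by blast
qed

text \<open>Since \<open>\<chi>\<close> is not \<open>- 1\<close>, every neighbour has its first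
  half in \<open>H\<close>, where \<open>orth_v1_H\<close> lists the candidates. The candidate
  \<open>v1\<close> drops out because edges join distinct lines.\<close>

lemma edge_v1_iff:
  assumes "\<gamma> n * \<gamma> m * \<kappa> = 1"
  shows "{span {v1}, L} \<in> cd_edges \<gamma> n \<longleftrightarrow> L = span {v0} \<or> L = span {v2}"
proof
  assume "{span {v1}, L} \<in> cd_edges \<gamma> n"
  then obtain a b where ab: "a \<in> cd_E' n" "b \<in> B" "L = span {cd_pair n a b}" "L \<noteq> span {v1}"
      "cd_orth \<gamma> (Suc n) v1 (cd_pair n a b)"
    using edge_v_iff[of v1 L] by auto
  have "a \<in> H"
    using orth_outside_chi[OF cd_E'_pm_E[OF ab(1)] _ ab(2) _ ab(5)] assms by auto
  from orth_v1_H[OF this cd_E'_neq[OF ab(1)] ab(2,5)]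
  obtain s v where "s \<in> {1,-1::real}" "v \<in> {v0, v1, v2}" "cd_pair n a b = s *\<^sub>R v" by blast
  moreover from this have "span {cd_pair n a b} = span {v}"
    using span_singleton_scale[of s v] by auto
  ultimately show "L = span {v0} \<or> L = span {v2}" using ab(3,4) by auto
next
  assume "L = span {v0} \<or> L = span {v2}"
  then show "{span {v1}, L} \<in> cd_edges \<gamma> n"
    using edge_vI[of v1 v0] edge_vI[of v1 v2] orth_path[OF assms] span_distinct by auto
qed

lemma edge_v2_iff:
  assumes "\<gamma> n * \<gamma> m * \<kappa> = 1"
  shows "{span {v2}, L} \<in> cd_edges \<gamma> n \<longleftrightarrow> L = span {v1} \<or> L = span {v3}"
proof
  assume "{span {v2}, L} \<in> cd_edges \<gamma> n"
  then obtain a b where ab: "a \<in> cd_E' n" "b \<in> B" "L = span {cd_pair n a b}" "L \<noteq> span {v2}"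
      "cd_orth \<gamma> (Suc n) v2 (cd_pair n a b)"
    using edge_v_iff[of v2 L] by auto
  have "a \<in> H"
    using orth_outside_chi[OF cd_E'_pm_E[OF ab(1)] _ ab(2) _ ab(5)] assms by auto
  from orth_v2_H[OF this cd_E'_neq[OF ab(1)] ab(2,5)]
  obtain s v where "s \<in> {1,-1::real}" "v \<in> {v1, v2, v3}" "cd_pair n a b = s *\<^sub>R v" by blast
  moreover from this have "span {cd_pair n a b} = span {v}"
    using span_singleton_scale[of s v] by auto
  ultimately show "L = span {v1} \<or> L = span {v3}" using ab(3,4) by auto
next
  assume "L = span {v1} \<or> L = span {v3}"
  then show "{span {v2}, L} \<in> cd_edges \<gamma> n"
    using edge_vI[of v2 v1] edge_vI[of v2 v3] orth_path[OF assms] span_distinct by auto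
qed

lemma chi_eq_1_path:
  assumes "\<gamma> n * \<gamma> m * \<kappa> = 1"
  shows "{span {v0}, span {v1}, span {v2}, span {v3}} \<subseteq> cd_vertices \<gamma> n"
    "{E \<in> cd_edges \<gamma> n. span {v1} \<in> E \<or> span {v2} \<in> E} =
       {{span {v0}, span {v1}}, {span {v1}, span {v2}}, {span {v2}, span {v3}}}"
proof -
  have vert: "span {v} \<in> cd_vertices \<gamma> n"
    if "v \<in> {v0, v1, v2, v3}" "cd_orth \<gamma> (Suc n) v w" "w \<in> {v0, v1, v2, v3}" for v w
  proof -
    have "cd_zero_divisor \<gamma> (Suc n) v"
      by (rule cd_orth_zero_divisor[OF that(2)]) (use that(1,3) v_nonzero in auto)
    with that(1) show ?thesis
      by (elim v_form) (simp add: cd_pm_Ze'_iff)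
  qed
  show "{span {v0}, span {v1}, span {v2}, span {v3}} \<subseteq> cd_vertices \<gamma> n"
    using vert[of v0 v1] vert[of v1 v1] vert[of v2 v2] vert[of v3 v2] orth_path[OF assms] cd_orth_sym by auto
  show "{E \<in> cd_edges \<gamma> n. span {v1} \<in> E \<or> span {v2} \<in> E} =
       {{span {v0}, span {v1}}, {span {v1}, span {v2}}, {span {v2}, span {v3}}}" (is "?l = ?r")
  proof (intro equalityI subsetI)
    fix E assume E: "E \<in> ?l"
    then have "E \<in> cd_edges \<gamma> n" by simp
    from E have "span {v1} \<in> E \<or> span {v2} \<in> E" by simp
    then show "E \<in> ?r"
    proof
      assume "span {v1} \<in> E"
      with \<open>E \<in> cd_edges \<gamma> n\<close> obtain L where L: "E = {span {v1}, L}"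
        by (rule cd_edgesE)
      then have "L = span {v0} \<or> L = span {v2}"
        using \<open>E \<in> cd_edges \<gamma> n\<close> edge_v1_iff[OF assms, of L] by simp
      then show ?thesis unfolding L by (elim disjE) (simp_all add: insert_commute)
    next
      assume "span {v2} \<in> E"
      with \<open>E \<in> cd_edges \<gamma> n\<close> obtain L where L: "E = {span {v2}, L}"
        by (rule cd_edgesE)
      then have "L = span {v1} \<or> L = span {v3}"
        using \<open>E \<in> cd_edges \<gamma> n\<close> edge_v2_iff[OF assms, of L] by simp
      then show ?thesis unfolding L by (elim disjE) (simp_all add: insert_commute)
    qed
  next
    have edges: "{span {v1}, span {v0}} \<in> cd_edges \<gamma> n" "{span {v1}, span {v2}} \<in> cd_edges \<gamma> n"
      "{span {v2}, span {v3}} \<in> cd_edges \<gamma> n"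
      by (simp_all add: edge_v1_iff[OF assms] edge_v2_iff[OF assms])
    fix E assume "E \<in> ?r"
    then consider "E = {span {v1}, span {v0}}" | "E = {span {v1}, span {v2}}" | "E = {span {v2}, span {v3}}"
      by (simp only: insert_iff empty_iff insert_commute[of "span {v0}"]) blast
    then show "E \<in> ?l"
      by cases (use edges in simp_all)
  qed
qed

end

section \<open>Perpendicularity and the case \<open>\<chi> = - 1\<close>\<close>

lemma cd_form_eq:
  "cd_form \<gamma> k a b = (Poly_Mapping.lookup (cd_mult \<gamma> k a (cd_conj k b)) 0 +
     Poly_Mapping.lookup (cd_mult \<gamma> k b (cd_conj k a)) 0) / 2"
  by (simp add: cd_form_def lookup_add)

text \<open>The vectors annihilated by the form with \<open>a\<close> make up a subspace, so
  spanning vectors suffice.\<close>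

lemma cd_perp_span_iff: "cd_perp \<gamma> k a (span S) \<longleftrightarrow> (\<forall>h\<in>S. cd_form \<gamma> k a h = 0)"
proof
  assume "cd_perp \<gamma> k a (span S)"
  then show "\<forall>h\<in>S. cd_form \<gamma> k a h = 0"
    using span_base unfolding cd_perp_def by blast
next
  assume *: "\<forall>h\<in>S. cd_form \<gamma> k a h = 0"
  have "subspace {h. cd_form \<gamma> k a h = 0}"
    by (auto simp: subspace_def cd_form_eq lookup_add add_eq_0_iff2)
  with * have "span S \<subseteq> {h. cd_form \<gamma> k a h = 0}"
    by (intro span_minimal) auto
  then show "cd_perp \<gamma> k a (span S)"
    unfolding cd_perp_def by blast
qed

context cd_doubled
begin

text \<open>Basis elements that differ beyond sign are perpendicular by
  \<open>cd_pm_E_anticomm_conj\<close>, whereas an element of \<open>H\<close> pairs with one of the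
  four generators to plus or minus its norm, which is nonzero.\<close>

lemma perp_iff:
  assumes a: "a \<in> B"
  shows "cd_perp \<gamma> n a (span {cd_e 0, c, t, u}) \<longleftrightarrow> a \<notin> H"
proof -
  have "cd_form \<gamma> n a h = 0" if "a \<notin> H" "h \<in> {cd_e 0, c, t, u}" for h
  proof -
    have h: "h \<in> B" "a \<noteq> h" "a \<noteq> - h"
      using notin_H[OF a that(1)] that(2) by auto
    show ?thesis
      using cd_pm_E_anticomm_conj[OF a h] by (simp add: cd_form_eq)
  qed
  moreover have "\<exists>h\<in>{cd_e 0, c, t, u}. cd_form \<gamma> n a h \<noteq> 0" if aH: "a \<in> H"
  proof -
    obtain s h where s: "s \<in> {1,-1::real}" "h \<in> {cd_e 0, c, t, u}" "a = s *\<^sub>R h"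
      using aH by (rule H_cases)
    have "h \<in> B" using s(2) by auto
    then have "cd_norm \<gamma> n h \<noteq> 0"
      using cd_norm_cases[of h n] by auto
    then have "cd_form \<gamma> n a h \<noteq> 0"
      using s(1) by (auto simp: s(3) cd_form_eq cd_norm_def)
    with s(2) show ?thesis by blast
  qed
  ultimately show ?thesis unfolding cd_perp_span_iff by blast
qed

lemma outside_exists:
  assumes "m \<ge> 2"
  obtains a where "a \<in> cd_E' n" "a \<notin> H"
proof -
  obtain p i where i: "p \<in> {1,-1::real}" "i < 2 ^ n" "c = p *\<^sub>R cd_e i"
    using c_B by (rule cd_pm_EE)
  have "u \<in> B" by simp
  then obtain q j where j: "q \<in> {1,-1::real}" "j < 2 ^ n" "u = q *\<^sub>R cd_e j"
    by (rule cd_pm_EE)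
  \<comment> \<open>The elements of \<open>H\<close> involve only the indices of \<open>e_0\<close>,
    \<open>c\<close>, \<open>t\<close> and \<open>u\<close>, at most four of the at least eight
    available.\<close>
  have "card {0, i, 2 ^ m, j} \<le> 4"
    by (simp add: card_insert_if)
  moreover have "card {..<(2::nat) ^ n} \<ge> 8"
    using power_increasing[of 3 n "2::nat"] assms by simp
  ultimately have "\<not> {..<2 ^ n} \<subseteq> {0, i, 2 ^ m, j}"
    using card_mono[of "{0, i, 2 ^ m, j}" "{..<2 ^ n}"] by auto
  then obtain k where k: "k < 2 ^ n" "k \<notin> {0, i, 2 ^ m, j}" by blast
  have "cd_e k \<notin> H"
  proof
    assume "cd_e k \<in> H"
    then obtain s h where s: "s \<in> {1,-1::real}" "h \<in> {cd_e 0, c, t, u}" "cd_e k = s *\<^sub>R h"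
      by (rule H_cases)
    from s(2) have "h = cd_e 0 \<or> h = p *\<^sub>R cd_e i \<or> h = cd_e (2 ^ m) \<or> h = q *\<^sub>R cd_e j"
      unfolding i(3)[symmetric] j(3)[symmetric] by (auto simp: cd_te0_def)
    then show False
      using k i(1) j(1) s(1,3) by auto
  qed
  moreover have "cd_e k \<in> cd_E' n"
    using k by (auto simp: cd_E'_def cd_E_def)
  ultimately show thesis by (rule that[rotated])
qed

lemma zero_divisor_ge_3:
  assumes "m \<ge> 2" "\<gamma> n * \<gamma> m * \<kappa> = - 1" "v \<in> {v1, v2}"
  shows "cd_zero_divisor \<gamma> (Suc n) v"
proof -
  obtain a where a: "a \<in> cd_E' n" "a \<notin> H"
    using assms(1) by (rule outside_exists)
  \<comment> \<open>This is the solution of \<open>b c = t a\<close> from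
    \<open>outside_iff\<close>; because \<open>\<chi> = - 1\<close> it solves the other equation
    too.\<close>
  define b where "b = - (\<kappa> *\<^sub>R ((c \<odot> a) \<odot> t))"
  have aB: "a \<in> B" by (rule cd_E'_pm_E) fact
  have b: "b \<in> B"
    unfolding b_def cd_pm_E_minus by (rule cd_pm_E_scale) (use aB \<kappa>(1) in auto)
  have "\<gamma> n * \<gamma> m = - \<kappa>" using assms(2) \<kappa>(1) by auto
  then have "cd_orth \<gamma> (Suc n) v (cd_pair n a b)"
    using assms(3) orth_outside[OF aB a(2) b] outside_iff[OF aB a(2) b] b_def by (auto simp: scaleR_minus_left)
  then show ?thesis
    by (rule cd_orth_zero_divisor)
      (use assms(3) v_nonzero cd_pm_E_nonzero[OF aB] aB b in \<open>auto simp: cd_pair_eq_0_iff\<close>)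
qed

lemma conj_v: "v \<in> {v1, v2} \<Longrightarrow> cd_conj (Suc n) v = - v"
  by (auto simp: cd_pair_uminus)

text \<open>Here \<open>y\<close> is arbitrary, so basis arguments are replaced by associativity of
  the second algebra. One component of \<open>v y = 0\<close> is solved for \<open>b\<close>;
  substituting its conjugate into the other component yields \<open>2 (c a) = 0\<close> for
  \<open>v1\<close> and \<open>2 (t a) = 0\<close> for \<open>v2\<close>.\<close>

lemma left_mult_eq_0:
  assumes m: "m = 1" and chi: "\<gamma> n * \<gamma> m * \<kappa> = - 1" and v: "v \<in> {v1, v2}"
    and y: "y \<in> cd_carrier (Suc n)" "cd_mult \<gamma> (Suc n) v y = 0"
  shows "y = 0"
proof -
  have n: "n = 2" using m by simp
  have assoc: "(x \<odot> y) \<odot> z = x \<odot> (y \<odot> z)"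
    if "x \<in> cd_carrier n" "y \<in> cd_carrier n" "z \<in> cd_carrier n" for x y z
    using that cd_assoc[of x y z \<gamma>] unfolding n by simp
  obtain a b where ab [simp]: "a \<in> cd_carrier n" "b \<in> cd_carrier n" and yab: "y = cd_pair n a b"
    using y(1) by (rule cd_carrier_SucE)
  have zero: "z = 0" if "x \<in> B" "z \<in> cd_carrier n" "x \<odot> z = 0 \<or> z \<odot> x = 0" for x z
    using that cd_cancel[of x n z 0] by auto
  have "a = 0 \<and> b = 0"
  proof (cases "v = v1")
    case True
    then have eqs: "c \<odot> a + \<gamma> n *\<^sub>R (cd_conj n b \<odot> t) = 0" "b \<odot> c + t \<odot> cd_conj n a = 0"
      using y(2) by (simp_all add: yab cd_pair_eq_0_iff)
    have "b = \<kappa> *\<^sub>R ((b \<odot> c) \<odot> c)" using \<kappa> by simp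
    also have "b \<odot> c = - (t \<odot> cd_conj n a)" using eqs(2) by (simp add: add_eq_0_iff2)
    finally have b: "b = - (\<kappa> *\<^sub>R ((t \<odot> cd_conj n a) \<odot> c))"
      by simp
    have "cd_conj n b = - \<kappa> *\<^sub>R (c \<odot> (a \<odot> t))"
      by (subst b) (simp add: cd_mult_conj)
    then have "cd_conj n b \<odot> t = - (\<kappa> * \<gamma> m) *\<^sub>R (c \<odot> a)"
      by (simp add: assoc cd_sq_te0)
    with eqs(1) have "(1 - \<gamma> n * \<gamma> m * \<kappa>) *\<^sub>R (c \<odot> a) = 0"
      by (simp add: algebra_simps)
    then have "c \<odot> a = 0" by (simp add: chi)
    then have "a = 0" using zero[of c a] by simp
    moreover from this have "b = 0" using eqs(2) zero[of c b] by simp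
    ultimately show ?thesis by simp
  next
    case False
    with v have "v = v2" by simp
    then have eqs: "t \<odot> a + cd_conj n b \<odot> c = 0" "b \<odot> t + \<gamma> n *\<^sub>R (c \<odot> cd_conj n a) = 0"
      using y(2) by (simp_all add: yab cd_pair_eq_0_iff)
    have "b = \<gamma> m *\<^sub>R ((b \<odot> t) \<odot> t)" by (simp add: cd_sq_te0)
    also have "b \<odot> t = - (\<gamma> n *\<^sub>R (c \<odot> cd_conj n a))" using eqs(2) by (simp add: add_eq_0_iff2)
    finally have b: "b = - ((\<gamma> n * \<gamma> m) *\<^sub>R ((c \<odot> cd_conj n a) \<odot> t))"
      by (simp add: mult.commute)
    have "cd_conj n b = - (\<gamma> n * \<gamma> m) *\<^sub>R (t \<odot> (a \<odot> c))"
      by (subst b) (simp add: cd_mult_conj)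
    then have "cd_conj n b \<odot> c = - (\<gamma> n * \<gamma> m * \<kappa>) *\<^sub>R (t \<odot> a)"
      by (simp add: assoc)
    with eqs(1) have "2 *\<^sub>R (t \<odot> a) = 0"
      by (simp add: chi scaleR_2)
    then have "a = 0" using zero[of t a] by simp
    moreover from this have "b = 0" using eqs(2) zero[of t b] by simp
    ultimately show ?thesis by simp
  qed
  then show ?thesis by (simp add: yab)
qed

lemma zero_divisor_iff:
  assumes chi: "\<gamma> n * \<gamma> m * \<kappa> = - 1" and v: "v \<in> {v1, v2}"
  shows "cd_zero_divisor \<gamma> (Suc n) v \<longleftrightarrow> n \<ge> 3"
proof (cases "m \<ge> 2")
  case True
  then show ?thesis using zero_divisor_ge_3[OF True chi v] by simp
next
  case False
  \<comment> \<open>For \<open>n = 1\<close> the only basis elements are \<open>e_0\<close> and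
    \<open>t\<close>, so there is no admissible \<open>c\<close>.\<close>
  have "m \<noteq> 0"
  proof
    assume "m = 0"
    with c show False
      by (auto simp: cd_pm_def cd_E''_def cd_E_def cd_te0_def less_2_cases_iff)
  qed
  with False have m: "m = 1" by simp
  have "\<not> cd_zero_divisor \<gamma> (Suc n) v"
  proof
    assume "cd_zero_divisor \<gamma> (Suc n) v"
    then obtain y where y: "y \<in> cd_carrier (Suc n)" "y \<noteq> 0"
      "cd_mult \<gamma> (Suc n) v y = 0 \<or> cd_mult \<gamma> (Suc n) y v = 0"
      and "v \<in> cd_carrier (Suc n)"
      unfolding cd_zero_divisor_def by blast
    \<comment> \<open>Conjugation reverses products and negates \<open>v\<close>, so annihilation
      from the left becomes annihilation from the right.\<close>
    then have "cd_mult \<gamma> (Suc n) v (cd_conj (Suc n) y) = 0" if "cd_mult \<gamma> (Suc n) y v = 0"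
      using cd_mult_conj[of y "Suc n" v \<gamma>] that conj_v[OF v] by simp
    then have "y = 0 \<or> cd_conj (Suc n) y = 0"
      using left_mult_eq_0[OF m chi v] y(1,3) cd_conj_carrier by blast
    then show False
      using y(1,2) cd_conj_conj[of y "Suc n"] by auto
  qed
  with False show ?thesis by simp
qed

lemma neighbours:
  assumes chi: "\<gamma> n * \<gamma> m * \<kappa> = - 1" and v: "v \<in> {v1, v2}"
  shows "{L. {span {v}, L} \<in> cd_edges \<gamma> n} =
    {span {cd_pair n a b} | a b. a \<in> cd_carrier n \<and> b \<in> cd_carrier n \<and> cd_pair n a b \<in> cd_Ze' \<gamma> n \<and>
       cd_perp \<gamma> n a (span {cd_e 0, c, t, u}) \<and> a \<odot> b = (\<gamma> m * cd_norm \<gamma> n b) *\<^sub>R u}"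
proof -
  have v': "v \<in> {v0, v1, v2, v3}" using v by auto
  \<comment> \<open>Orthogonality with first half in \<open>H\<close> would force
    \<open>\<chi> = 1\<close>.\<close>
  have not_H: "a \<notin> H" if "a \<in> B" "a \<notin> {cd_e 0, - cd_e 0}" "b \<in> B" "cd_orth \<gamma> (Suc n) v (cd_pair n a b)" for a b
    using orth_v1_H[OF _ that(2,3)] orth_v2_H[OF _ that(2,3)] that(4) v chi by auto
  obtain x y where xy: "x \<in> B" "x \<notin> {cd_e 0, - cd_e 0}" "y \<in> B" "v = cd_pair n x y" "x \<in> H"
    using v c_neq t_neq that[of c t] that[of t "\<gamma> n *\<^sub>R c"] H_gens by auto
  \<comment> \<open>Excluding the line of \<open>v\<close> from its neighbours removes nothing: the
    first half of \<open>v\<close> lies in \<open>H\<close>, so \<open>v\<close> is not orthogonal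
    to itself.\<close>
  have no_loop: "span {cd_pair n a b} \<noteq> span {v}"
    if "a \<in> B" "b \<in> B" "cd_orth \<gamma> (Suc n) v (cd_pair n a b)" for a b
  proof
    have "cd_pair n a b \<noteq> 0"
      using that cd_pm_E_nonzero[of a n] by (simp add: cd_pair_eq_0_iff)
    moreover assume "span {cd_pair n a b} = span {v}"
    ultimately obtain r where "r \<noteq> 0" "cd_pair n a b = r *\<^sub>R v"
      by (metis span_singleton_eqE)
    with that(3) have "cd_orth \<gamma> (Suc n) v v" by (simp add: cd_orth_scale)
    then show False using not_H[OF xy(1-3)] xy(4,5) by simp
  qed
  \<comment> \<open>Orthogonality to \<open>v\<close> already makes the pair a zero divisor, so the
    equivalence comes down to \<open>perp_iff\<close> and
    \<open>orth_outside_iff_mult\<close>.\<close>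
  have key: "(L \<noteq> span {v} \<and> cd_orth \<gamma> (Suc n) v (cd_pair n a b)) \<longleftrightarrow>
      (cd_pair n a b \<in> cd_Ze' \<gamma> n \<and> cd_perp \<gamma> n a (span {cd_e 0, c, t, u}) \<and>
       a \<odot> b = (\<gamma> m * cd_norm \<gamma> n b) *\<^sub>R u)"
    if a: "a \<in> cd_E' n" and b: "b \<in> B" and L: "L = span {cd_pair n a b}" for a b L
  proof -
    have aB: "a \<in> B" by (rule cd_E'_pm_E) fact
    have zd: "cd_pair n a b \<in> cd_Ze' \<gamma> n" if "cd_orth \<gamma> (Suc n) v (cd_pair n a b)"
    proof -
      have "cd_zero_divisor \<gamma> (Suc n) (cd_pair n a b)"
        by (rule cd_orth_zero_divisor[OF cd_orth_sym[THEN iffD1, OF that]])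
          (use v v_nonzero cd_pm_E_nonzero[OF aB] aB b in \<open>auto simp: cd_pair_eq_0_iff\<close>)
      with a b show ?thesis unfolding cd_Ze'_iff by blast
    qed
    show ?thesis
      unfolding perp_iff[OF aB] L
      using not_H[OF aB cd_E'_neq[OF a] b] no_loop[OF aB b] zd
        orth_outside_iff_mult[OF aB _ b v chi] by blast
  qed
  show ?thesis (is "?l = ?r")
  proof (intro equalityI subsetI)
    fix L assume "L \<in> ?l"
    then obtain a b where "a \<in> cd_E' n" "b \<in> B" "L = span {cd_pair n a b}"
      "L \<noteq> span {v} \<and> cd_orth \<gamma> (Suc n) v (cd_pair n a b)"
      using edge_v_iff[OF v', of L] by auto
    with key[of a b L] cd_E'_pm_E[of a n] show "L \<in> ?r"
      by (intro CollectI exI[of _ a] exI[of _ b] conjI cd_pm_E_carrier) auto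
  next
    fix L assume "L \<in> ?r"
    then obtain a b where ab: "a \<in> cd_carrier n" "b \<in> cd_carrier n" "L = span {cd_pair n a b}"
      "cd_pair n a b \<in> cd_Ze' \<gamma> n \<and> cd_perp \<gamma> n a (span {cd_e 0, c, t, u}) \<and>
       a \<odot> b = (\<gamma> m * cd_norm \<gamma> n b) *\<^sub>R u" by blast
    then have "a \<in> cd_E' n" "b \<in> B"
      using cd_pair_Ze'_iff[of a n b \<gamma>] by auto
    with ab key[of a b L] show "L \<in> ?l"
      using edge_v_iff[OF v', of L] by blast
  qed
qed

lemma v_pm_Ze':
  assumes "v \<in> {v1, v2}"
  shows "v \<in> cd_pm (cd_Ze' \<gamma> n) \<longleftrightarrow> cd_zero_divisor \<gamma> (Suc n) v"
proof -
  have "v \<in> {v0, v1, v2, v3}" using assms by auto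
  then show ?thesis by (elim v_form) (rule cd_pm_Ze'_iff)
qed

end

theorem lemma6p12:
  fixes \<gamma> :: "nat \<Rightarrow> real" and n :: nat and c :: cd
  assumes "\<And>k. \<gamma> k \<in> {1, -1}"
    and "n \<ge> 1"
    and "c \<in> cd_pm (cd_E'' n)"
  shows
    "let t = cd_te0 n; c' = cd_tilde \<gamma> n c;
         v0 = cd_pair n c' (- \<gamma> (n - 1) *\<^sub>R cd_e 0);
         v1 = cd_pair n c t;
         v2 = cd_pair n t (\<gamma> n *\<^sub>R c);
         v3 = cd_pair n c' (\<gamma> (n - 1) *\<^sub>R cd_e 0)
     in
       cd_chi \<gamma> n v1 = cd_chi \<gamma> n v2 \<and>
       (cd_chi \<gamma> n v1 = 1 \<longrightarrow>
          cd_orth \<gamma> (Suc n) v1 v1 \<and> cd_orth \<gamma> (Suc n) v2 v2 \<and>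
          {span {v0}, span {v1}, span {v2}, span {v3}} \<subseteq> cd_vertices \<gamma> n \<and>
          distinct [span {v0}, span {v1}, span {v2}, span {v3}] \<and>
          {E \<in> cd_edges \<gamma> n. span {v1} \<in> E \<or> span {v2} \<in> E} =
            {{span {v0}, span {v1}}, {span {v1}, span {v2}}, {span {v2}, span {v3}}}) \<and>
       (cd_chi \<gamma> n v1 = -1 \<longrightarrow>
          (\<forall>v\<in>{v1, v2}.
             {L. {span {v}, L} \<in> cd_edges \<gamma> n} =
               {span {cd_pair n a b} | a b.
                  a \<in> cd_carrier n \<and> b \<in> cd_carrier n \<and> cd_pair n a b \<in> cd_Ze' \<gamma> n \<and>
                  cd_perp \<gamma> n a (span {cd_e 0, c, t, c'}) \<and>
                  cd_mult \<gamma> n a b = (\<gamma> (n - 1) * cd_norm \<gamma> n b) *\<^sub>R c'} \<and>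
             (cd_zero_divisor \<gamma> (Suc n) v \<longleftrightarrow> n \<ge> 3) \<and>
             (v \<in> cd_pm (cd_Ze' \<gamma> n) \<longleftrightarrow> n \<ge> 3)))"
proof -
  \<comment> \<open>With \<open>n = Suc m\<close> the parameter with index \<open>n - 1\<close>
    becomes \<open>\<gamma> m\<close>, as in the locale.\<close>
  obtain m where n: "n = Suc m"
    using assms(2) by (cases n) auto
  interpret cd_doubled \<gamma> m c
    by unfold_locales (use assms n in auto)
  have p1: "cd_orth \<gamma> (Suc (Suc m)) v1 v1 \<and> cd_orth \<gamma> (Suc (Suc m)) v2 v2 \<and>
      {span {v0}, span {v1}, span {v2}, span {v3}} \<subseteq> cd_vertices \<gamma> (Suc m) \<and>
      distinct [span {v0}, span {v1}, span {v2}, span {v3}] \<and>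
      {E \<in> cd_edges \<gamma> (Suc m). span {v1} \<in> E \<or> span {v2} \<in> E} =
        {{span {v0}, span {v1}}, {span {v1}, span {v2}}, {span {v2}, span {v3}}}"
    if "cd_chi \<gamma> (Suc m) v1 = 1"
    using that unfolding chi by (intro conjI chi_eq_1_path orth_path span_distinct)
  have p2: "\<forall>v\<in>{v1, v2}.
      {L. {span {v}, L} \<in> cd_edges \<gamma> (Suc m)} =
        {span {cd_pair (Suc m) a b} | a b.
           a \<in> cd_carrier (Suc m) \<and> b \<in> cd_carrier (Suc m) \<and> cd_pair (Suc m) a b \<in> cd_Ze' \<gamma> (Suc m) \<and>
           cd_perp \<gamma> (Suc m) a (span {cd_e 0, c, t, u}) \<and>
           cd_mult \<gamma> (Suc m) a b = (\<gamma> m * cd_norm \<gamma> (Suc m) b) *\<^sub>R u} \<and>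
      (cd_zero_divisor \<gamma> (Suc (Suc m)) v \<longleftrightarrow> Suc m \<ge> 3) \<and>
      (v \<in> cd_pm (cd_Ze' \<gamma> (Suc m)) \<longleftrightarrow> Suc m \<ge> 3)"
    if "cd_chi \<gamma> (Suc m) v1 = - 1"
  proof (intro ballI conjI)
    fix v assume v: "v \<in> {v1, v2}"
    note chi' = that[unfolded chi]
    show "cd_zero_divisor \<gamma> (Suc (Suc m)) v \<longleftrightarrow> Suc m \<ge> 3"
      by (rule zero_divisor_iff[OF chi' v])
    then show "v \<in> cd_pm (cd_Ze' \<gamma> (Suc m)) \<longleftrightarrow> Suc m \<ge> 3"
      unfolding v_pm_Ze'[OF v] .
  qed (rule neighbours, use that chi in simp_all)
  show ?thesis
    unfolding n Let_def cd_tilde_def diff_Suc_1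
    by (intro conjI impI p1 p2) (simp_all only: chi)
qed

end
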